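(* Let $F$ be a simple rational function of degree $m\geq 4$, let $r\geq 1$ be an integer, and let $G,X$ be non-constant rational functions such that $$F^{\circ r}\circ X=X\circ G .$$ Then there exist a Möbius transformation $\mu$ and an integer $l\geq 0$ such that $$X=F^{\circ l}\circ\mu,\qquad G=\mu^{-1}\circ F^{\circ r}\circ\mu .$$
   Context: Rational functions are rational functions of one complex variable, viewed as maps $\mathbb{C}\mathbb{P}^1\to\mathbb{C}\mathbb{P}^1$. A rational function $F$ of degree $m\ge 2$ is called simple if for every $z\in\mathbb{C}\mathbb{P}^1$ the preimage $F^{-1}\{z\}$ contains at least $m-1$ (distinct) points. $F^{\circ l}$ denotes the $l$-th iterate of $F$, with $F^{\circ 0}=\mathrm{id}$. *)

theory Defs
  imports "HOL-Computational_Algebra.Computational_Algebra" Complex_Main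
begin

(* CP^1 as the one-point compactification of the plane: Some z is the point [z : 1],
   None is the point at infinity [1 : 0]. *)
type_synonym cp1 = "complex option"

(* The map [x : y] |-> [p^h(x,y) : q^h(x,y)], where p^h and q^h are the homogenisations of
   p and q of common degree n = max (degree p) (degree q).  At infinity these take the values
   coeff p n and coeff q n.  Meaningful for coprime p and q, when the two coordinates never
   vanish simultaneously. *)
definition rat_map :: "complex poly \<Rightarrow> complex poly \<Rightarrow> cp1 \<Rightarrow> cp1" where
  "rat_map p q w =
     (let quot = (\<lambda>a b. if b = 0 then None else Some (a / b));
          n = max (degree p) (degree q)
      in case w of
           Some z \<Rightarrow> quot (poly p z) (poly q z)
         | None \<Rightarrow> quot (coeff p n) (coeff q n))"

(* The representation p / q in lowest terms is unique up to a common scalar, so a map has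
   at most one degree. *)
definition rational_function_of_degree :: "nat \<Rightarrow> (cp1 \<Rightarrow> cp1) \<Rightarrow> bool" where
  "rational_function_of_degree n F \<longleftrightarrow>
     (\<exists>p q. coprime p q \<and> q \<noteq> 0 \<and> max (degree p) (degree q) = n \<and> F = rat_map p q)"

definition rational_function :: "(cp1 \<Rightarrow> cp1) \<Rightarrow> bool" where
  "rational_function F \<longleftrightarrow> (\<exists>n. rational_function_of_degree n F)"

(* Fibres of a rational function of degree at least 2 are finite, so card really counts them. *)
definition simple_rational_function :: "nat \<Rightarrow> (cp1 \<Rightarrow> cp1) \<Rightarrow> bool" where
  "simple_rational_function m F \<longleftrightarrow>
     m \<ge> 2 \<and> rational_function_of_degree m F \<and> (\<forall>z. card (F -` {z}) \<ge> m - 1)"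

definition moebius :: "(cp1 \<Rightarrow> cp1) \<Rightarrow> bool" where
  "moebius \<mu> \<longleftrightarrow> (\<exists>a b c d. a * d - b * c \<noteq> 0 \<and> \<mu> = rat_map [:b, a:] [:d, c:])"

end

theory Submission
  imports Defs "HOL-Computational_Algebra.Field_as_Ring"
begin

text \<open>
  The heart of the matter: if \<open>F \<circ> Y = X \<circ> G\<close> with \<open>F\<close> simple of degree \<open>m \<ge> 4\<close> and \<open>X\<close> of degree \<open>n \<ge> 2\<close>,
  then \<open>Y\<close> is a rational function of \<open>G\<close>. Consider the curve \<open>F(x) = X(y)\<close>, parametrised by \<open>(Y, G)\<close>.
  If \<open>A(x, y) = A\<^sub>0(y) + A\<^sub>1(y) x + A\<^sub>2(y) x\<^sup>2\<close> has degree at most \<open>n - 2\<close> in \<open>y\<close> and satisfies the adjoint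
  conditions at the singular points of the curve, then the differential form \<open>A dy / \<partial>\<^sub>x(F(x) - X(y))\<close> pulls back
  to a holomorphic form on the projective line, so \<open>A(Y, G) = 0\<close>. As the critical points of \<open>F\<close> are simple and have
  distinct values, the adjoint conditions number at most \<open>2n - 2\<close>, the number of critical points of \<open>X\<close>.
  Hence solutions \<open>A\<close> exist with \<open>A\<^sub>2\<close> a multiple of any prescribed monomial, and comparing those for the monomials
  \<open>1\<close> and \<open>y\<^sup>n\<^sup>-\<^sup>2\<close> yields a nontrivial relation \<open>A\<^sub>0(G) + A\<^sub>1(G) Y = 0\<close>.

  For \<open>F\<^sup>r \<circ> X = X \<circ> G\<close> this is applied to \<open>Y = F\<^sup>r\<^sup>-\<^sup>1 \<circ> X\<close>. From \<open>Y = Z \<circ> G\<close> one gets \<open>X = F \<circ> Z\<close> and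
  \<open>F\<^sup>r \<circ> Z = Z \<circ> G\<close>, and induction on the degree of \<open>X\<close> concludes.
\<close>

section \<open>Complex polynomials and Wronskians\<close>

lemma coprime_complex_poly_iff:
  fixes p q :: "complex poly"
  shows "coprime p q \<longleftrightarrow> (\<forall>z. \<not> (poly p z = 0 \<and> poly q z = 0))"
proof
  assume cop: "coprime p q"
  show "\<forall>z. \<not> (poly p z = 0 \<and> poly q z = 0)"
  proof (intro allI notI)
    fix z assume "poly p z = 0 \<and> poly q z = 0"
    then have "[:-z, 1:] dvd p" "[:-z, 1:] dvd q" by (auto simp: poly_eq_0_iff_dvd)
    with cop have "is_unit [:-z, 1:]" by (rule coprime_common_divisor)
    then show False by (simp add: is_unit_poly_iff)
  qed
next
  assume none: "\<forall>z. \<not> (poly p z = 0 \<and> poly q z = 0)"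
  have "\<not> (0 < degree (gcd p q))"
  proof
    assume "0 < degree (gcd p q)"
    then obtain z where "poly (gcd p q) z = 0" using alg_closed_imp_poly_has_root by blast
    then have "[:-z, 1:] dvd p" "[:-z, 1:] dvd q"
      by (meson dvd_trans gcd_dvd1 gcd_dvd2 poly_eq_0_iff_dvd)+
    with none show False by (auto simp: poly_eq_0_iff_dvd)
  qed
  moreover have "gcd p q \<noteq> 0" using none by auto
  ultimately have "is_unit (gcd p q)" using is_unit_iff_degree[of "gcd p q"] by blast
  then show "coprime p q" using is_unit_gcd by blast
qed

lemma dvd_by_order:
  fixes p q :: "complex poly"
  assumes "p \<noteq> 0" "q \<noteq> 0" "\<And>z. order z p \<le> order z q"
  shows "p dvd q"
proof -
  have "proots p \<subseteq># proots q"
    using assms by (intro mset_subset_eqI) simp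
  then have "(\<Prod>x\<in>#proots p. [:- x, 1:]) dvd (\<Prod>x\<in>#proots q. [:- x, 1:])"
    by (intro prod_mset_subset_imp_dvd image_mset_subseteq_mono)
  then have "smult (lead_coeff p) (\<Prod>x\<in>#proots p. [:- x, 1:])
      dvd smult (lead_coeff q) (\<Prod>x\<in>#proots q. [:- x, 1:])"
    using assms by (simp add: smult_dvd_iff dvd_smult)
  then show ?thesis by (simp only: complex_poly_decompose_multiset)
qed

section \<open>Divisibility, congruences and linear dependence of polynomials\<close>

lemma prod_dvd_if_pairwise_coprime:
  fixes f :: "'a \<Rightarrow> 'b::semiring_gcd"
  assumes "finite A" "\<And>i. i \<in> A \<Longrightarrow> f i dvd h"
    and "\<And>i j. i \<in> A \<Longrightarrow> j \<in> A \<Longrightarrow> i \<noteq> j \<Longrightarrow> coprime (f i) (f j)"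
  shows "prod f A dvd h"
  using assms
proof (induction A rule: finite_induct)
  case (insert i A)
  have "coprime (f i) (prod f A)"
    using insert by (intro prod_coprime_right) auto
  with insert show ?case by (auto intro!: divides_mult)
qed simp

text \<open>Correcting \<open>\<xi>\<close> by a multiple of the product of the earlier moduli keeps
  the earlier congruences; a Bezout identity makes the correction meet the new one.\<close>

lemma chinese_remainder_family:
  fixes D x :: "'a \<Rightarrow> 'b::euclidean_ring_gcd"
  assumes "finite A"
    and "\<And>i j. i \<in> A \<Longrightarrow> j \<in> A \<Longrightarrow> i \<noteq> j \<Longrightarrow> coprime (D i) (D j)"
  shows "\<exists>\<xi>. \<forall>i\<in>A. D i dvd \<xi> - x i"
  using assms
proof (induction A rule: finite_induct)
  case (insert i A)
  then obtain \<xi> where \<xi>: "\<forall>j\<in>A. D j dvd \<xi> - x j" by blast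
  have "coprime (prod D A) (D i)"
    using insert by (intro prod_coprime_left) auto
  then obtain s t where st: "s * prod D A + t * D i = 1"
    by (metis bezout_coefficients_fst_snd coprime_iff_gcd_eq_1)
  let ?\<eta> = "\<xi> + s * prod D A * (x i - \<xi>)"
  have "?\<eta> - x i = (1 - s * prod D A) * (\<xi> - x i)" by (simp add: algebra_simps)
  also have "1 - s * prod D A = t * D i" using st by (simp add: algebra_simps)
  finally have "D i dvd ?\<eta> - x i" by simp
  moreover have "D j dvd ?\<eta> - x j" if "j \<in> A" for j
  proof -
    have "?\<eta> - x j = (\<xi> - x j) + prod D A * (s * (x i - \<xi>))" by (simp add: algebra_simps)
    moreover have "D j dvd prod D A" using that insert by auto
    ultimately show ?thesis using \<xi> that by (metis dvd_add dvd_mult2)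
  qed
  ultimately show ?case by (intro exI[of _ ?\<eta>]) auto
qed simp

text \<open>The polynomials of degree below \<open>k\<close> form a space of dimension
  \<open>k\<close>. The induction is Gaussian elimination on the top coefficient with pivot
  \<open>f p\<close>.\<close>

lemma poly_family_dependent:
  fixes f :: "'a \<Rightarrow> 'b::field poly"
  assumes "finite I" "k < card I" "\<And>i. i \<in> I \<Longrightarrow> f i = 0 \<or> degree (f i) < k"
  shows "\<exists>c. (\<exists>i\<in>I. c i \<noteq> 0) \<and> (\<Sum>i\<in>I. smult (c i) (f i)) = 0"
  using assms
proof (induction k arbitrary: I f)
  case 0
  then obtain i where "i \<in> I" by fastforce
  with 0 show ?case by (intro exI[of _ "\<lambda>_. 1"]) auto
next
  case (Suc k)
  show ?case
  proof (cases "\<forall>i\<in>I. coeff (f i) k = 0")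
    case True
    have "f i = 0 \<or> degree (f i) < k" if "i \<in> I" for i
      using Suc.prems(3)[OF that] True that
      by (metis leading_coeff_0_iff less_Suc_eq)
    with Suc show ?thesis by simp
  next
    case False
    then obtain p where p: "p \<in> I" "coeff (f p) k \<noteq> 0" by auto
    define \<rho> where "\<rho> i = coeff (f i) k / coeff (f p) k" for i
    define g where "g i = f i - smult (\<rho> i) (f p)" for i
    have "g i = 0 \<or> degree (g i) < k" if "i \<in> I - {p}" for i
    proof -
      have "coeff (g i) k = 0" using p by (simp add: g_def \<rho>_def)
      moreover have "degree (g i) \<le> k"
      proof -
        have "degree (f i) \<le> k" "degree (f p) \<le> k"
          using Suc.prems(3) that p by fastforce+
        then show ?thesis unfolding g_def
          by (meson degree_diff_le degree_smult_le order.trans)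
      qed
      ultimately show ?thesis by (metis leading_coeff_0_iff order_le_less)
    qed
    moreover have "k < card (I - {p})" using Suc.prems p by simp
    ultimately obtain c where c: "\<exists>i\<in>I - {p}. c i \<noteq> 0"
      "(\<Sum>i\<in>I - {p}. smult (c i) (g i)) = 0"
      using Suc.IH[of "I - {p}" g] Suc.prems(1) by blast
    \<comment> \<open>The coefficient of the pivot absorbs all multiples of \<open>f p\<close> that
      were subtracted in the \<open>g i\<close>.\<close>
    define c' where "c' = c(p := - (\<Sum>i\<in>I - {p}. c i * \<rho> i))"
    have "(\<Sum>i\<in>I. smult (c' i) (f i))
        = smult (c' p) (f p) + (\<Sum>i\<in>I - {p}. smult (c' i) (f i))"
      using Suc.prems p by (simp add: sum.remove)
    also have "(\<Sum>i\<in>I - {p}. smult (c' i) (f i)) = (\<Sum>i\<in>I - {p}. smult (c i) (f i))"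
      by (intro sum.cong) (auto simp: c'_def)
    also have "smult (c' p) (f p) = - (\<Sum>i\<in>I - {p}. smult (c i * \<rho> i) (f p))"
      by (simp add: c'_def smult_sum)
    also have "- (\<Sum>i\<in>I - {p}. smult (c i * \<rho> i) (f p)) + (\<Sum>i\<in>I - {p}. smult (c i) (f i))
        = (\<Sum>i\<in>I - {p}. smult (c i) (g i))"
      by (simp add: g_def smult_diff_right sum_subtractf)
    finally have "(\<Sum>i\<in>I. smult (c' i) (f i)) = 0" using c by simp
    moreover have "\<exists>i\<in>I. c' i \<noteq> 0" using c by (auto simp: c'_def)
    ultimately show ?thesis by blast
  qed
qed

section \<open>The Wronskian as numerator of the derivative of \<open>a / b\<close>\<close>

definition wronskian :: "complex poly \<Rightarrow> complex poly \<Rightarrow> complex poly" where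
  "wronskian a b = pderiv a * b - a * pderiv b"

text \<open>Subtracting a constant from \<open>a / b\<close> does not change its derivative.\<close>

lemma wronskian_diff_smult: "wronskian (a - smult v b) b = wronskian a b"
  by (simp add: wronskian_def pderiv_diff pderiv_smult algebra_simps)

lemma dvd_wronskian_if_square_dvd:
  assumes "D\<^sup>2 dvd a"
  shows "D dvd wronskian a b"
proof -
  obtain S where "a = D\<^sup>2 * S" using assms by blast
  then show ?thesis
    by (auto simp: wronskian_def pderiv_mult power2_eq_square intro!: dvd_diff dvd_add dvd_mult dvd_mult2)
qed

text \<open>A vanishing Wronskian would make each of two coprime polynomials divide its own
  derivative.\<close>

lemma wronskian_nonzero:
  assumes cop: "coprime a b" and pos: "0 < max (degree a) (degree b)"
  shows "wronskian a b \<noteq> 0"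
proof
  assume "wronskian a b = 0"
  then have eq: "pderiv a * b = a * pderiv b" by (simp add: wronskian_def)
  then have "b dvd a * pderiv b" "a dvd pderiv a * b" by (metis dvd_triv_left dvd_triv_right)+
  then have "b dvd pderiv b" "a dvd pderiv a"
    using cop by (simp_all add: coprime_dvd_mult_left_iff coprime_dvd_mult_right_iff coprime_commute)
  with pos show False by simp
qed

text \<open>The two terms of formal degree \<open>n\<close> have vanishing Wronskian, which lowers
  the degree to \<open>2 * n - 2\<close>. For coprime polynomials of maximal degree
  \<open>n\<close>, the coefficient there detects whether infinity is a critical point.\<close>

lemma
  assumes a: "degree a \<le> n" and b: "degree b \<le> n" and n: "n \<ge> 1"
  shows degree_wronskian_le: "degree (wronskian a b) \<le> 2 * n - 2"
    and coeff_wronskian: "coeff (wronskian a b) (2 * n - 2)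
      = coeff a n * coeff b (n - 1) - coeff a (n - 1) * coeff b n"
proof -
  obtain k where k: "n = Suc k" using n by (cases n) auto
  define \<alpha> \<beta> where "\<alpha> = coeff a n" and "\<beta> = coeff b n"
  define a' b' where "a' = a - monom \<alpha> n" and "b' = b - monom \<beta> n"
  have a': "degree a' \<le> k"
  proof -
    have "degree a' \<le> n" unfolding a'_def
      by (intro degree_diff_le a) (simp add: degree_monom_le)
    moreover have "coeff a' n = 0" by (simp add: a'_def \<alpha>_def)
    ultimately show ?thesis using k
      by (metis degree_0 le_0_eq leading_coeff_0_iff le_SucE zero_le)
  qed
  have b': "degree b' \<le> k"
  proof -
    have "degree b' \<le> n" unfolding b'_def
      by (intro degree_diff_le b) (simp add: degree_monom_le)
    moreover have "coeff b' n = 0" by (simp add: b'_def \<beta>_def)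
    ultimately show ?thesis using k
      by (metis degree_0 le_0_eq leading_coeff_0_iff le_SucE zero_le)
  qed
  have da': "degree (pderiv a') \<le> k - 1" using a' by (simp add: degree_pderiv)
  have db': "degree (pderiv b') \<le> k - 1" using b' by (simp add: degree_pderiv)
  have a_eq: "a = monom \<alpha> n + a'" and b_eq: "b = monom \<beta> n + b'"
    by (simp_all add: a'_def b'_def)
  have mm: "pderiv (monom \<alpha> n) * monom \<beta> n = monom \<alpha> n * pderiv (monom \<beta> n)"
    by (simp add: pderiv_monom mult_monom mult_ac add.commute)
  have w: "wronskian a b = monom (of_nat n * \<alpha>) k * b' - monom (of_nat n * \<beta>) k * a'
      - monom \<alpha> n * pderiv b' + monom \<beta> n * pderiv a' + wronskian a' b'"
    unfolding a_eq b_eq wronskian_def pderiv_add using mm k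
    by (simp add: pderiv_monom algebra_simps)
  have ww: "degree (wronskian a' b') \<le> 2 * k - 1"
  proof -
    have "degree (pderiv a' * b') \<le> k - 1 + k" "degree (a' * pderiv b') \<le> k + (k - 1)"
      using a' b' da' db' by (meson add_mono degree_mult_le order_trans)+
    then show ?thesis unfolding wronskian_def by (intro degree_diff_le) auto
  qed
  have k0: "wronskian a' b' = 0" if "k = 0"
  proof -
    have "pderiv a' = 0" "pderiv b' = 0" using a' b' that by (simp_all add: pderiv_eq_0_iff)
    then show ?thesis by (simp add: wronskian_def)
  qed
  have d1: "degree (monom c k * e) \<le> 2 * k" if "degree e \<le> k" for c and e :: "complex poly"
    using degree_mult_le[of "monom c k" e] degree_monom_le[of c k] that by linarith
  have d2: "degree (monom c n * pderiv e) \<le> 2 * k" if "degree e \<le> k" for c and e :: "complex poly"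
  proof (cases "k = 0")
    case True
    then have "pderiv e = 0" using that by (simp add: pderiv_eq_0_iff)
    then show ?thesis by simp
  next
    case False
    then show ?thesis
    using degree_mult_le[of "monom c n" "pderiv e"] degree_monom_le[of c n] that k
    by (simp add: degree_pderiv)
  qed
  have "degree (wronskian a b) \<le> 2 * k"
    unfolding w using a' b' ww by (intro degree_diff_le degree_add_le d1 d2) auto
  then show "degree (wronskian a b) \<le> 2 * n - 2" using k by simp
  have c0: "coeff (wronskian a' b') (2 * k) = 0"
    using ww k0 by (cases "k = 0") (auto intro!: coeff_eq_0)
  have c1: "coeff (monom c n * pderiv e) (2 * k) = c * of_nat k * coeff e k" for c and e :: "complex poly"
    using k by (cases k) (auto simp: coeff_monom_mult coeff_pderiv)
  have "coeff (wronskian a b) (2 * k) = \<alpha> * coeff b' k - \<beta> * coeff a' k"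
  proof -
    have c2: "coeff (monom c k * e) (2 * k) = c * coeff e k" for c and e :: "complex poly"
      by (simp add: coeff_monom_mult)
    show ?thesis unfolding w coeff_add coeff_diff c0 c1 c2
      by (simp add: k algebra_simps)
  qed
  moreover have "coeff a' k = coeff a k" "coeff b' k = coeff b k"
    using k by (simp_all add: a'_def b'_def)
  ultimately show "coeff (wronskian a b) (2 * n - 2)
      = coeff a n * coeff b (n - 1) - coeff a (n - 1) * coeff b n"
    using k by (simp add: \<alpha>_def \<beta>_def mult.commute)
qed

section \<open>Homogeneous substitution\<close>

text \<open>The binary form of degree \<open>n\<close> with dehomogenisation \<open>p\<close>; coefficients of \<open>p\<close> beyond \<open>n\<close> are ignored.\<close>

definition hom_eval :: "nat \<Rightarrow> complex poly \<Rightarrow> complex \<Rightarrow> complex \<Rightarrow> complex" where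
  "hom_eval n p x y = (\<Sum>i\<le>n. coeff p i * x ^ i * y ^ (n - i))"

text \<open>This is \<open>b ^ n * p (a / b)\<close> with denominators cleared. The formal degree
  \<open>n\<close> may exceed that of \<open>p\<close>, so that numerator and denominator of a map
  can share one \<open>n\<close>.\<close>

definition hom_subst :: "nat \<Rightarrow> complex poly \<Rightarrow> complex poly \<Rightarrow> complex poly \<Rightarrow> complex poly" where
  "hom_subst n p a b = (\<Sum>i\<le>n. smult (coeff p i) (a ^ i * b ^ (n - i)))"

lemma poly_hom_subst: "poly (hom_subst n p a b) t = hom_eval n p (poly a t) (poly b t)"
  by (simp add: hom_subst_def hom_eval_def poly_sum mult.assoc)

lemma hom_eval_infinity: "hom_eval n p x 0 = coeff p n * x ^ n"
proof -
  have "hom_eval n p x 0 = (\<Sum>i\<le>n. if i = n then coeff p n * x ^ n else 0)"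
    unfolding hom_eval_def by (intro sum.cong) auto
  then show ?thesis by simp
qed

lemma hom_eval_finite:
  assumes "degree p \<le> n" "y \<noteq> 0"
  shows "hom_eval n p x y = y ^ n * poly p (x / y)"
proof -
  have "poly p (x / y) = (\<Sum>i\<le>n. coeff p i * (x / y) ^ i)"
    unfolding poly_altdef using assms(1)
    by (intro sum.mono_neutral_left) (auto simp: coeff_eq_0)
  then show ?thesis
    using assms(2) unfolding hom_eval_def
    by (auto simp: sum_distrib_left power_divide power_diff field_simps intro!: sum.cong)
qed

lemma hom_subst_add: "hom_subst n (p + q) a b = hom_subst n p a b + hom_subst n q a b"
  by (simp add: hom_subst_def smult_add_left sum.distrib)

lemma hom_subst_diff: "hom_subst n (p - q) a b = hom_subst n p a b - hom_subst n q a b"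
  by (simp add: hom_subst_def smult_diff_left sum_subtractf)

lemma hom_subst_smult: "hom_subst n (smult c p) a b = smult c (hom_subst n p a b)"
  by (simp add: hom_subst_def poly_eq_iff coeff_sum sum_distrib_left mult.assoc)

lemma hom_subst_0 [simp]: "hom_subst n 0 a b = 0"
  by (simp add: hom_subst_def)

lemma hom_subst_linear: "hom_subst (Suc 0) [:c, d:] a b = smult d a + smult c b"
  by (simp add: hom_subst_def add.commute)

lemma coeff_mult_formal_degrees:
  fixes p q :: "'a::comm_semiring_0 poly"
  assumes "degree p \<le> n" "degree q \<le> k"
  shows "coeff (p * q) (n + k) = coeff p n * coeff q k"
proof (cases "degree p = n \<and> degree q = k")
  case True
  then show ?thesis using coeff_mult_degree_sum[of p q] by simp
next
  case False
  then have "degree p < n \<or> degree q < k" using assms by auto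
  moreover from this have "degree p + degree q < n + k" using assms by linarith
  then have "coeff (p * q) (n + k) = 0"
    by (intro coeff_eq_0) (metis degree_mult_le le_less_trans)
  ultimately show ?thesis by (auto simp: coeff_eq_0)
qed

text \<open>Compared pointwise: where \<open>b\<close> vanishes only the coefficients of formal
  degree survive, and elsewhere dehomogenising reduces the claim to multiplicativity of
  evaluation.\<close>

lemma hom_subst_mult:
  assumes "degree p \<le> n" "degree q \<le> k"
  shows "hom_subst (n + k) (p * q) a b = hom_subst n p a b * hom_subst k q a b"
proof (rule poly_ext)
  fix t
  have d: "degree (p * q) \<le> n + k"
    using assms by (meson add_mono degree_mult_le order_trans)
  note c = coeff_mult_formal_degrees[OF assms]
  show "poly (hom_subst (n + k) (p * q) a b) t = poly (hom_subst n p a b * hom_subst k q a b) t"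
  proof (cases "poly b t = 0")
    case True
    then show ?thesis by (simp add: poly_hom_subst hom_eval_infinity c power_add)
  next
    case False
    then show ?thesis using assms d by (simp add: poly_hom_subst hom_eval_finite power_add)
  qed
qed

lemma hom_subst_monom: "i \<le> n \<Longrightarrow> hom_subst n (monom c i) a b = smult c (a ^ i * b ^ (n - i))"
proof -
  assume "i \<le> n"
  have "hom_subst n (monom c i) a b = (\<Sum>j\<le>n. if j = i then smult c (a ^ i * b ^ (n - i)) else 0)"
    unfolding hom_subst_def by (intro sum.cong) auto
  then show ?thesis using \<open>i \<le> n\<close> by simp
qed

text \<open>At infinity this rests on \<open>n\<close> being the exact maximum of the degrees: one
  of the two coefficients of degree \<open>n\<close> is nonzero.\<close>

lemma hom_eval_coprime:
  assumes cop: "coprime p q" and xy: "x \<noteq> 0 \<or> y \<noteq> 0" and n: "n = max (degree p) (degree q)"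
  shows "hom_eval n p x y \<noteq> 0 \<or> hom_eval n q x y \<noteq> 0"
proof (cases "y = 0")
  case True
  have "coeff p n \<noteq> 0 \<or> coeff q n \<noteq> 0"
  proof (cases "p = 0 \<and> q = 0")
    case True
    then show ?thesis using cop by simp
  next
    case False
    then show ?thesis using n
      by (metis coprime_0_left_iff coprime_0_right_iff cop degree_0 is_unit_iff_degree
          leading_coeff_neq_0 max.commute max_def)
  qed
  then show ?thesis using True xy by (auto simp: hom_eval_infinity)
next
  case False
  then show ?thesis using cop n
    by (simp add: hom_eval_finite coprime_complex_poly_iff)
qed

lemma coprime_hom_subst:
  assumes "coprime p q" "coprime a b" "n = max (degree p) (degree q)"
  shows "coprime (hom_subst n p a b) (hom_subst n q a b)"
  unfolding coprime_complex_poly_iff poly_hom_subst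
  using assms hom_eval_coprime[OF assms(1) _ assms(3)]
  by (auto simp: coprime_complex_poly_iff)

section \<open>Degrees and values at infinity of homogeneous substitutions\<close>

lemma degree_hom_subst_le:
  assumes "degree a \<le> k" "degree b \<le> k"
  shows "degree (hom_subst n p a b) \<le> n * k"
  unfolding hom_subst_def
proof (rule degree_sum_le)
  fix i assume "i \<in> {..n}"
  then have i: "i \<le> n" by simp
  have "degree (a ^ i * b ^ (n - i)) \<le> k * i + k * (n - i)"
    using assms by (meson add_mono degree_mult_le degree_power_le mult_le_mono1 order_trans)
  also have "\<dots> = n * k" using i by (simp flip: add_mult_distrib2)
  finally show "degree (smult (coeff p i) (a ^ i * b ^ (n - i))) \<le> n * k"
    using degree_smult_le order_trans by blast
qed simp

lemma coeff_power_formal_degree: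
  fixes p :: "'a::comm_semiring_1 poly"
  assumes "degree p \<le> k"
  shows "coeff (p ^ i) (i * k) = coeff p k ^ i"
proof (induction i)
  case (Suc i)
  have "degree (p ^ i) \<le> i * k"
    using assms by (metis degree_power_le mult.commute mult_le_mono1 order_trans)
  then show ?case using coeff_mult_formal_degrees[OF assms, of "p ^ i" "i * k"] Suc by simp
qed simp

text \<open>The coefficient of formal degree acts as the value at infinity, so this is the analogue
  of \<open>poly_hom_subst\<close> there.\<close>

lemma coeff_hom_subst:
  assumes "degree a \<le> k" "degree b \<le> k"
  shows "coeff (hom_subst n p a b) (n * k) = hom_eval n p (coeff a k) (coeff b k)"
proof -
  have "coeff (a ^ i * b ^ (n - i)) (n * k) = coeff a k ^ i * coeff b k ^ (n - i)" if "i \<le> n" for i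
  proof -
    have "degree (a ^ i) \<le> i * k" "degree (b ^ (n - i)) \<le> (n - i) * k"
      using assms by (metis degree_power_le mult.commute mult_le_mono1 order_trans)+
    from coeff_mult_formal_degrees[OF this] show ?thesis using that assms
      by (simp add: coeff_power_formal_degree flip: add_mult_distrib)
  qed
  then show ?thesis
    unfolding hom_subst_def hom_eval_def by (simp add: coeff_sum mult.assoc)
qed

lemma coeff_max_degree_nonzero:
  assumes "coprime p q" "n = max (degree p) (degree (q :: complex poly))"
  shows "coeff p n \<noteq> 0 \<or> coeff q n \<noteq> 0"
  using hom_eval_coprime[OF assms(1) _ assms(2), of 1 0] by (simp add: hom_eval_infinity)

text \<open>No cancellation lowers the degree: the coefficients of degree \<open>n * k\<close> are
  the two forms evaluated at the image of infinity, and these cannot both vanish.\<close>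

lemma max_degree_hom_subst:
  assumes "coprime p q" "coprime a b" "n = max (degree p) (degree q)" "k = max (degree a) (degree b)"
  shows "max (degree (hom_subst n p a b)) (degree (hom_subst n q a b)) = n * k"
proof (rule antisym)
  have ab: "degree a \<le> k" "degree b \<le> k" using assms by simp_all
  show "max (degree (hom_subst n p a b)) (degree (hom_subst n q a b)) \<le> n * k"
    using degree_hom_subst_le[OF ab] by simp
  have "coeff a k \<noteq> 0 \<or> coeff b k \<noteq> 0" using coeff_max_degree_nonzero assms by blast
  from hom_eval_coprime[OF assms(1) this assms(3)]
  have "coeff (hom_subst n p a b) (n * k) \<noteq> 0 \<or> coeff (hom_subst n q a b) (n * k) \<noteq> 0"
    by (simp add: coeff_hom_subst[OF ab])
  then show "n * k \<le> max (degree (hom_subst n p a b)) (degree (hom_subst n q a b))"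
    using le_degree by (metis max.coboundedI1 max.coboundedI2)
qed

text \<open>A nonconstant \<open>a / b\<close> attains a finite value \<open>z\<close> that is not a
  root of \<open>p\<close>.\<close>

lemma hom_subst_nonzero:
  assumes cop: "coprime a b" and pos: "0 < max (degree a) (degree b)"
    and p: "p \<noteq> 0" "degree p \<le> n"
  shows "hom_subst n p a b \<noteq> 0"
proof -
  define k where "k = max (degree a) (degree b)"
  \<comment> \<open>\<open>r\<close> vanishes at the roots of \<open>p\<close> and at the value of
    \<open>a / b\<close> at infinity if that is finite. For other \<open>z\<close> the coefficient
    of degree \<open>k\<close> in \<open>a - smult z b\<close> is nonzero, so this polynomial has a
    root.\<close>
  define r where "r = p * [:coeff a k, - coeff b k:]"
  have "coeff a k \<noteq> 0 \<or> coeff b k \<noteq> 0" using coeff_max_degree_nonzero[OF cop k_def] .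
  then have "r \<noteq> 0" using p unfolding r_def by (metis mult_eq_0_iff neg_equal_0_iff_equal pCons_eq_0_iff)
  then have "finite {z. poly r z = 0}" by (rule poly_roots_finite)
  then obtain z where "poly r z \<noteq> 0"
    using ex_new_if_finite[OF infinite_UNIV_char_0, of "{z. poly r z = 0}"] by blast
  then have z: "poly p z \<noteq> 0" "coeff (a - smult z b) k \<noteq> 0" by (auto simp: r_def algebra_simps)
  then have "degree (a - smult z b) > 0"
    using pos by (metis coeff_eq_0 k_def not_gr_zero)
  then obtain t where t: "poly (a - smult z b) t = 0" using alg_closed_imp_poly_has_root by blast
  then have bt: "poly b t \<noteq> 0" using cop by (auto simp: coprime_complex_poly_iff)
  then have "poly a t / poly b t = z" using t by (simp add: field_simps)
  then have "poly (hom_subst n p a b) t \<noteq> 0"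
    using p(2) bt z(1) by (simp add: poly_hom_subst hom_eval_finite)
  then show ?thesis by auto
qed

section \<open>Rational functions on the Riemann sphere\<close>

text \<open>The point \<open>[x : y]\<close>; the pair \<open>(0, 0)\<close> is sent to infinity as a junk value.\<close>

definition proj_point :: "complex \<Rightarrow> complex \<Rightarrow> cp1" where
  "proj_point x y = (if y = 0 then None else Some (x / y))"

lemma rat_map_Some: "rat_map p q (Some z) = proj_point (poly p z) (poly q z)"
  by (simp add: rat_map_def proj_point_def)

lemma rat_map_None:
  "n = max (degree p) (degree q) \<Longrightarrow> rat_map p q None = proj_point (coeff p n) (coeff q n)"
  by (simp add: rat_map_def proj_point_def Let_def)

lemma proj_point_eq_iff:
  assumes "x \<noteq> 0 \<or> y \<noteq> 0" "u \<noteq> 0 \<or> v \<noteq> 0"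
  shows "proj_point x y = proj_point u v \<longleftrightarrow> v * x = u * y"
  using assms by (auto simp: proj_point_def field_simps)

lemma proj_point_cases:
  obtains x y where "w = proj_point x y" "x \<noteq> 0 \<or> y \<noteq> 0"
proof (cases w)
  case None
  then show ?thesis using that[of 1 0] by (simp add: proj_point_def)
next
  case (Some z)
  then show ?thesis using that[of z 1] by (simp add: proj_point_def)
qed

lemma rat_map_proj_point:
  assumes "x \<noteq> 0 \<or> y \<noteq> 0" "n = max (degree p) (degree q)"
  shows "rat_map p q (proj_point x y) = proj_point (hom_eval n p x y) (hom_eval n q x y)"
proof (cases "y = 0")
  case True
  then show ?thesis using assms
    by (auto simp: proj_point_def rat_map_def hom_eval_infinity Let_def)
next
  case False
  then show ?thesis using assms
    by (auto simp: proj_point_def rat_map_def hom_eval_finite Let_def)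
qed

lemma rat_map_coords:
  fixes a b :: "complex poly"
  assumes "coprime a b" "k = max (degree a) (degree b)"
  shows "poly a z \<noteq> 0 \<or> poly b z \<noteq> 0" "coeff a k \<noteq> 0 \<or> coeff b k \<noteq> 0"
  using assms(1) coeff_max_degree_nonzero[OF assms] by (auto simp: coprime_complex_poly_iff)

lemma rat_map_comp:
  assumes "coprime p q" "coprime a b" "n = max (degree p) (degree q)"
  shows "rat_map p q \<circ> rat_map a b = rat_map (hom_subst n p a b) (hom_subst n q a b)"
proof
  fix w
  define k where "k = max (degree a) (degree b)"
  note nz = rat_map_coords[OF assms(2) k_def]
  show "(rat_map p q \<circ> rat_map a b) w = rat_map (hom_subst n p a b) (hom_subst n q a b) w"
  proof (cases w)
    case None
    have "degree a \<le> k" "degree b \<le> k" by (simp_all add: k_def)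
    then show ?thesis
      using None nz max_degree_hom_subst[OF assms(1,2,3) k_def]
      by (simp add: rat_map_None[OF k_def] rat_map_None[of "n * k"] rat_map_proj_point[OF _ assms(3)]
          coeff_hom_subst)
  next
    case (Some z)
    then show ?thesis
      using nz(1)[of z] by (simp add: rat_map_Some rat_map_proj_point[OF _ assms(3)] poly_hom_subst)
  qed
qed

lemma rational_function_of_degree_comp:
  assumes "rational_function_of_degree n F" "rational_function_of_degree k H" "k \<ge> 1"
  shows "rational_function_of_degree (n * k) (F \<circ> H)"
proof -
  from assms obtain p q a b where pq: "coprime p q" "q \<noteq> 0" "n = max (degree p) (degree q)"
    "F = rat_map p q" and ab: "coprime a b" "k = max (degree a) (degree b)" "H = rat_map a b"
    unfolding rational_function_of_degree_def by metis
  have "hom_subst n q a b \<noteq> 0"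
    using assms(3) ab pq by (intro hom_subst_nonzero) auto
  then show ?thesis
    unfolding rational_function_of_degree_def using pq ab
    by (metis rat_map_comp max_degree_hom_subst coprime_hom_subst)
qed

section \<open>Uniqueness of lowest terms and of the degree\<close>

lemma rat_map_smult: "c \<noteq> 0 \<Longrightarrow> rat_map (smult c p) (smult c q) = rat_map p q"
  by (auto simp: rat_map_def fun_eq_iff Let_def split: option.splits)

lemma coprime_fractions_proportional:
  fixes p q p' q' :: "complex poly"
  assumes "coprime p q" "q \<noteq> 0" "coprime p' q'" "q' \<noteq> 0" "p * q' = p' * q"
  obtains c where "c \<noteq> 0" "p = smult c p'" "q = smult c q'"
proof -
  have "q dvd q'" using assms(1,5)
    by (metis coprime_commute coprime_dvd_mult_right_iff dvd_triv_right)
  moreover have "q' dvd q" using assms(3,5)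
    by (metis coprime_commute coprime_dvd_mult_right_iff dvd_triv_right)
  ultimately have "degree q = degree q'"
    using assms(2,4) by (simp add: dvd_imp_degree_le order_antisym)
  moreover obtain r where r: "q = q' * r" using \<open>q' dvd q\<close> by blast
  ultimately have "degree r = 0" using assms(2) by (simp add: degree_mult_eq)
  then obtain c where c: "r = [:c:]" using degree_eq_zeroE by blast
  have q: "q = smult c q'" using r c by simp
  then have "c \<noteq> 0" using assms(2) by auto
  moreover have "p * q' = smult c p' * q'" using assms(5) q by simp
  then have "p = smult c p'" using assms(4) by (metis mult_right_cancel)
  ultimately show ?thesis using q that by blast
qed

lemma rat_map_eq_proportional:
  assumes "coprime p q" "q \<noteq> 0" "coprime p' q'" "q' \<noteq> 0" "rat_map p q = rat_map p' q'"
  obtains c where "c \<noteq> 0" "p = smult c p'" "q = smult c q'"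
proof -
  have "p * q' = p' * q"
  proof (rule poly_ext)
    fix z
    have "proj_point (poly p z) (poly q z) = proj_point (poly p' z) (poly q' z)"
      using assms(5) by (metis rat_map_Some)
    then show "poly (p * q') z = poly (p' * q) z"
      using proj_point_eq_iff rat_map_coords(1)[OF assms(1) refl, of z]
        rat_map_coords(1)[OF assms(3) refl, of z]
      by (simp add: mult.commute)
  qed
  with assms that show ?thesis by (blast intro: coprime_fractions_proportional)
qed

lemma rat_map_eqI:
  assumes "coprime p q" "q \<noteq> 0" "coprime p' q'" "q' \<noteq> 0" "p * q' = p' * q"
  shows "rat_map p q = rat_map p' q'"
  using coprime_fractions_proportional[OF assms] rat_map_smult by metis

lemma rational_function_degree_unique:
  assumes "rational_function_of_degree n F" "rational_function_of_degree k F"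
  shows "n = k"
proof -
  from assms obtain p q p' q' where *: "coprime p q" "q \<noteq> 0" "n = max (degree p) (degree q)"
    "F = rat_map p q" "coprime p' q'" "q' \<noteq> 0" "k = max (degree p') (degree q')" "F = rat_map p' q'"
    unfolding rational_function_of_degree_def by metis
  then obtain c where "c \<noteq> 0" "p = smult c p'" "q = smult c q'"
    using rat_map_eq_proportional[of p q p' q'] by auto
  then show ?thesis using * by simp
qed

lemma rational_function_of_degree_0:
  assumes "rational_function_of_degree 0 F"
  shows "\<exists>c. \<forall>z. F z = c"
proof -
  from assms obtain p q where *: "degree p = 0" "degree q = 0" "F = rat_map p q"
    unfolding rational_function_of_degree_def by auto
  obtain a b where "p = [:a:]" "q = [:b:]" using * by (metis degree_eq_zeroE)
  then have "F z = rat_map p q (Some 0)" for z using *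
    by (cases z) (simp_all add: rat_map_def Let_def)
  then show ?thesis by blast
qed

lemma rational_function_nonconstantE:
  assumes "rational_function F" "\<nexists>c. \<forall>z. F z = c"
  obtains n where "n \<ge> 1" "rational_function_of_degree n F"
  using assms rational_function_of_degree_0 unfolding rational_function_def
  by (metis less_one not_le)

section \<open>Fibres as zeros of members of a pencil, with infinity seen as a drop in
  degree\<close>

definition pencil :: "complex poly \<Rightarrow> complex poly \<Rightarrow> complex \<Rightarrow> complex \<Rightarrow> complex poly" where
  "pencil p q x y = smult y p - smult x q"

lemma rat_map_fibre:
  assumes "coprime p q" "n = max (degree p) (degree q)" "x \<noteq> 0 \<or> y \<noteq> 0"
  shows "rat_map p q -` {proj_point x y}
    = Some ` {z. poly (pencil p q x y) z = 0} \<union> (if coeff (pencil p q x y) n = 0 then {None} else {})"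
proof -
  have "rat_map p q w = proj_point x y \<longleftrightarrow>
      w \<in> Some ` {z. poly (pencil p q x y) z = 0} \<union> (if coeff (pencil p q x y) n = 0 then {None} else {})"
    for w
    using rat_map_coords(1)[OF assms(1,2)] rat_map_coords(2)[OF assms(1,2)] assms(3)
    by (cases w) (auto simp: rat_map_Some rat_map_None[OF assms(2)] proj_point_eq_iff pencil_def)
  then show ?thesis by auto
qed

lemma pencil_nonzero:
  assumes "coprime p q" "n = max (degree p) (degree q)" "x \<noteq> 0 \<or> y \<noteq> 0" "n \<ge> 1"
  shows "pencil p q x y \<noteq> 0"
proof
  assume "pencil p q x y = 0"
  then have eq: "smult y p = smult x q" by (simp add: pencil_def)
  have "degree p = 0 \<and> degree q = 0"
  proof (cases "y = 0")
    case True
    then have "q = 0" using eq assms(3) by simp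
    then show ?thesis using assms(1) by (auto simp: is_unit_poly_iff)
  next
    case False
    then have p: "p = smult (x / y) q" using eq
      by (metis (no_types) divide_inverse_commute smult_smult left_inverse smult_1_left)
    then have "q dvd p" by (metis dvd_refl dvd_smult)
    then have "is_unit q" using assms(1) by (simp add: coprime_absorb_right)
    then show ?thesis using p by (auto simp: is_unit_poly_iff)
  qed
  then show False using assms by simp
qed

lemma degree_pencil_le: "degree (pencil p q x y) \<le> max (degree p) (degree q)"
proof (unfold pencil_def, rule degree_diff_le)
  show "degree (smult y p) \<le> max (degree p) (degree q)"
    using degree_smult_le[of y p] by linarith
  show "degree (smult x q) \<le> max (degree p) (degree q)"
    using degree_smult_le[of x q] by linarith
qed

lemma card_rat_map_fibre:
  assumes "coprime p q" "n = max (degree p) (degree q)" "x \<noteq> 0 \<or> y \<noteq> 0" "n \<ge> 1"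
  shows "finite (rat_map p q -` {proj_point x y})"
    and "card (rat_map p q -` {proj_point x y})
      = card {z. poly (pencil p q x y) z = 0} + (if coeff (pencil p q x y) n = 0 then 1 else 0)"
proof -
  let ?R = "{z. poly (pencil p q x y) z = 0}"
  have fin: "finite ?R" using pencil_nonzero[OF assms] by (rule poly_roots_finite)
  then show "finite (rat_map p q -` {proj_point x y})"
    by (simp add: rat_map_fibre[OF assms(1-3)])
  have "card (Some ` ?R) = card ?R" by (simp add: card_image)
  then show "card (rat_map p q -` {proj_point x y})
      = card ?R + (if coeff (pencil p q x y) n = 0 then 1 else 0)"
    using fin by (auto simp: rat_map_fibre[OF assms(1-3)] card_insert_if)
qed

text \<open>A preimage at infinity costs the member of the pencil at least one degree, so finite
  roots and infinity together number at most \<open>n\<close>. If infinity is not a preimage, the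
  member has positive degree and hence a root.\<close>

lemma
  assumes "rational_function_of_degree n F" "n \<ge> 1"
  shows finite_fibre: "finite (F -` {w})"
    and card_fibre_le: "card (F -` {w}) \<le> n"
    and fibre_nonempty: "F -` {w} \<noteq> {}"
proof -
  from assms obtain p q where pq: "coprime p q" "n = max (degree p) (degree q)" "F = rat_map p q"
    unfolding rational_function_of_degree_def by metis
  obtain x y where xy: "w = proj_point x y" "x \<noteq> 0 \<or> y \<noteq> 0" by (rule proj_point_cases)
  let ?h = "pencil p q x y"
  have h: "?h \<noteq> 0" "degree ?h \<le> n"
    using pencil_nonzero[OF pq(1,2) xy(2) assms(2)] degree_pencil_le pq by auto
  note card = card_rat_map_fibre[OF pq(1,2) xy(2) assms(2)]
  show "finite (F -` {w})" using card xy pq by simp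
  have "card {z. poly ?h z = 0} \<le> degree ?h" using h by (intro card_poly_roots_bound)
  moreover have "coeff ?h n = 0 \<Longrightarrow> degree ?h < n"
    using h by (metis leading_coeff_0_iff order_le_less)
  ultimately show "card (F -` {w}) \<le> n" using card h xy pq by auto
  show "F -` {w} \<noteq> {}"
  proof (cases "coeff ?h n = 0")
    case True
    then show ?thesis using rat_map_fibre[OF pq(1,2) xy(2)] pq xy by simp
  next
    case False
    then have "degree ?h > 0" using h assms(2) by (intro le_degree[THEN order.strict_trans2[rotated]]) auto
    then obtain z where "poly ?h z = 0" using alg_closed_imp_poly_has_root by blast
    then show ?thesis using rat_map_fibre[OF pq(1,2) xy(2)] pq xy by auto
  qed
qed

lemma surj_rational_function:
  assumes "rational_function_of_degree n F" "n \<ge> 1"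
  shows "surj F"
  using fibre_nonempty[OF assms] by (metis vimage_singleton_eq surj_def ex_in_conv)

lemma inj_rational_function_of_degree_1:
  assumes "rational_function_of_degree 1 F"
  shows "inj F"
proof (rule injI)
  fix u v assume "F u = F v"
  then have "{u, v} \<subseteq> F -` {F u}" by auto
  then have "card {u, v} \<le> 1"
    using card_mono[OF finite_fibre[OF assms]] card_fibre_le[OF assms] by (meson order_trans le_refl)
  then show "u = v" by (cases "u = v") auto
qed

lemma moebius_if_degree_1:
  assumes "rational_function_of_degree 1 F"
  shows "moebius F"
proof -
  from assms obtain p q where pq: "coprime p q" "q \<noteq> 0" "max (degree p) (degree q) = 1" "F = rat_map p q"
    unfolding rational_function_of_degree_def by metis
  have linear: "\<exists>c d. r = [:c, d:]" if "degree r \<le> 1" for r :: "complex poly"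
    using that by (cases r rule: pCons_cases, rename_tac s, case_tac s rule: pCons_cases) (auto split: if_splits)
  obtain b a where p: "p = [:b, a:]" using linear[of p] pq(3) by (metis max.cobounded1)
  obtain d c where q: "q = [:d, c:]" using linear[of q] pq(3) by (metis max.cobounded2)
  have "a * d - b * c \<noteq> 0"
  proof
    assume 0: "a * d - b * c = 0"
    have "pencil p q a c = 0" using 0 by (simp add: pencil_def p q algebra_simps)
    moreover have "a \<noteq> 0 \<or> c \<noteq> 0" using pq(3) p q by auto
    ultimately show False using pencil_nonzero[of p q 1 a c] pq by simp
  qed
  then show ?thesis unfolding moebius_def using pq(4) p q by blast
qed

section \<open>Critical points of simple rational functions\<close>

lemma double_root_dvd:
  fixes h :: "complex poly"
  assumes "poly h z = 0" "poly (pderiv h) z = 0"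
  shows "[:-z, 1:]\<^sup>2 dvd h"
proof -
  obtain r where r: "h = [:-z, 1:] * r" using assms(1) by (auto simp: poly_eq_0_iff_dvd)
  have "poly r z = 0" using assms(2) unfolding r pderiv_mult by (simp add: pderiv_pCons)
  then obtain s where "r = [:-z, 1:] * s" by (auto simp: poly_eq_0_iff_dvd)
  then have "h = [:-z, 1:]\<^sup>2 * s" using r by (simp only: power2_eq_square mult.assoc)
  then show ?thesis by simp
qed

lemma card_roots_double_root:
  fixes h :: "complex poly"
  assumes "h \<noteq> 0" "poly h z = 0" "poly (pderiv h) z = 0"
  shows "card {x. poly h x = 0} < degree h"
proof -
  obtain s where s: "h = [:-z, 1:]\<^sup>2 * s" using double_root_dvd[OF assms(2,3)] by blast
  then have "s \<noteq> 0" using assms(1) by auto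
  have "{x. poly h x = 0} \<subseteq> insert z {x. poly s x = 0}" using s by auto
  then have "card {x. poly h x = 0} \<le> card (insert z {x. poly s x = 0})"
    using \<open>s \<noteq> 0\<close> by (intro card_mono) (auto simp: poly_roots_finite)
  also have "\<dots> \<le> Suc (card {x. poly s x = 0})" using \<open>s \<noteq> 0\<close> by (simp add: card_insert_if poly_roots_finite)
  also have "\<dots> \<le> Suc (degree s)" using \<open>s \<noteq> 0\<close> by (simp add: card_poly_roots_bound)
  also have "\<dots> < degree h"
    using \<open>s \<noteq> 0\<close> by (simp add: s degree_mult_eq degree_power_eq)
  finally show ?thesis .
qed

lemma card_roots_no_double_root:
  fixes h :: "complex poly"
  assumes "h \<noteq> 0" "\<And>z. poly h z = 0 \<Longrightarrow> poly (pderiv h) z \<noteq> 0"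
  shows "card {x. poly h x = 0} = degree h"
proof -
  have "rsquarefree h" using assms(2) by (auto simp: rsquarefree_roots)
  then have h: "h = smult (lead_coeff h) (\<Prod>z|poly h z = 0. [:-z, 1:])"
    by (simp add: complex_poly_decompose_rsquarefree)
  have "degree h = degree (\<Prod>z|poly h z = 0. [:-z, 1:])"
    using assms(1) by (subst h) simp
  also have "\<dots> = card {x. poly h x = 0}"
    by (subst degree_prod_eq_sum_degree) auto
  finally show ?thesis by simp
qed

lemma poly_pderiv_pencil:
  "poly (pderiv (pencil p q (poly p z) (poly q z))) z = poly (wronskian p q) z"
  by (simp add: pencil_def wronskian_def pderiv_diff pderiv_smult algebra_simps)

text \<open>The member of the pencil that vanishes at a critical point has a double root
  there.\<close>

lemma card_fibre_critical:
  assumes "coprime p q" "n = max (degree p) (degree q)" "n \<ge> 1" "poly (wronskian p q) z = 0"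
  shows "card (rat_map p q -` {rat_map p q (Some z)}) < n"
proof -
  note nz = rat_map_coords(1)[OF assms(1,2), of z]
  let ?h = "pencil p q (poly p z) (poly q z)"
  have h0: "?h \<noteq> 0" using pencil_nonzero[OF assms(1,2) nz assms(3)] .
  have "poly ?h z = 0" by (simp add: pencil_def)
  then have lt: "card {x. poly ?h x = 0} < degree ?h"
    using assms(4) h0 by (intro card_roots_double_root) (auto simp: poly_pderiv_pencil)
  have le: "degree ?h \<le> n" using degree_pencil_le assms(2) by simp
  moreover have "coeff ?h n = 0 \<Longrightarrow> degree ?h < n"
    using le h0 by (metis leading_coeff_0_iff order_le_less)
  ultimately show ?thesis
    using lt card_rat_map_fibre(2)[OF assms(1,2) nz assms(3)] by (auto simp: rat_map_Some)
qed

text \<open>Over any value other than \<open>F None\<close> and the images of zeros of the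
  Wronskian, the member of the pencil has degree \<open>n\<close> and only simple roots.\<close>

lemma finite_critical_values:
  assumes "rational_function_of_degree n F" "n \<ge> 1"
  shows "finite {w. card (F -` {w}) < n}"
proof -
  from assms obtain p q where pq: "coprime p q" "n = max (degree p) (degree q)" "F = rat_map p q"
    unfolding rational_function_of_degree_def by metis
  let ?Z = "{z. poly (wronskian p q) z = 0}"
  have "w \<in> insert (F None) (F ` Some ` ?Z)" if w: "card (F -` {w}) < n" for w
  proof (rule ccontr)
    assume notin: "w \<notin> insert (F None) (F ` Some ` ?Z)"
    obtain x y where xy: "w = proj_point x y" "x \<noteq> 0 \<or> y \<noteq> 0" by (rule proj_point_cases)
    let ?h = "pencil p q x y"
    have h0: "?h \<noteq> 0" using pencil_nonzero[OF pq(1,2) xy(2) assms(2)] .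
    have "coeff ?h n \<noteq> 0"
      using notin rat_map_fibre[OF pq(1,2) xy(2)] pq xy by auto
    then have deg: "degree ?h = n"
      using degree_pencil_le[of p q x y] pq(2) le_degree by (metis order_antisym)
    have "poly (pderiv ?h) z \<noteq> 0" if z: "poly ?h z = 0" for z
    proof
      assume d: "poly (pderiv ?h) z = 0"
      have "F (Some z) = w" using rat_map_fibre[OF pq(1,2) xy(2)] z pq xy by auto
      then have "poly (wronskian p q) z \<noteq> 0" using notin by auto
      moreover have "y * poly p z = x * poly q z" "y * poly (pderiv p) z = x * poly (pderiv q) z"
        using z d by (simp_all add: pencil_def pderiv_diff pderiv_smult)
      \<comment> \<open>Eliminating between the two linear relations shows that a multiple root is a
        zero of the Wronskian.\<close>
      then have "y * poly (wronskian p q) z = 0" "x * poly (wronskian p q) z = 0"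
        unfolding wronskian_def poly_diff poly_mult by algebra+
      ultimately show False using xy by auto
    qed
    then have "card {z. poly ?h z = 0} = n"
      using card_roots_no_double_root[OF h0] deg by simp
    then show False using w card_rat_map_fibre(2)[OF pq(1,2) xy(2) assms(2)] pq xy by simp
  qed
  then have "{w. card (F -` {w}) < n} \<subseteq> insert (F None) (F ` Some ` ?Z)" by blast
  moreover have "finite ?Z"
    using wronskian_nonzero[OF pq(1)] pq(2) assms(2) by (intro poly_roots_finite) simp
  ultimately show ?thesis by (meson finite_imageI finite_insert finite_subset)
qed

text \<open>By \<open>inf\<close>, infinity is neither a critical value nor a critical point. A
  fibre with at least \<open>m - 1\<close> points has room for a single double point, so critical
  points are exactly double and have distinct values. Hence the Wronskian has simple zeros, and
  their number is its degree, as in the Riemann-Hurwitz formula.\<close>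

lemma simple_critical_points:
  assumes cop: "coprime p q" and m: "m = max (degree p) (degree q)" "m \<ge> 2"
    and simple: "\<And>w. card (rat_map p q -` {w}) \<ge> m - 1"
    and inf: "card (rat_map p q -` {None}) = m"
      "card (rat_map p q -` {rat_map p q None}) = m"
  defines "C \<equiv> {x. poly (wronskian p q) x = 0}" and "v \<equiv> \<lambda>x. poly p x / poly q x"
  shows "card C = 2 * m - 2"
    and "\<And>x. x \<in> C \<Longrightarrow> card (rat_map p q -` {Some (v x)}) < m"
    and "\<And>x. x \<in> C \<Longrightarrow> \<exists>L. p - smult (v x) q = [:-x, 1:]\<^sup>2 * L \<and> poly L x \<noteq> 0"
    and "inj_on v C"
proof -
  have m1: "m \<ge> 1" using m by simp
  have q: "poly q x \<noteq> 0" if "x \<in> C" for x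
  proof
    assume "poly q x = 0"
    then have "rat_map p q (Some x) = None" by (simp add: rat_map_Some proj_point_def)
    then show False using card_fibre_critical[OF cop m(1) m1, of x] that inf by (simp add: C_def)
  qed
  then have v: "rat_map p q (Some x) = Some (v x)" if "x \<in> C" for x
    using that by (simp add: rat_map_Some proj_point_def v_def)
  then show cv: "card (rat_map p q -` {Some (v x)}) < m" if "x \<in> C" for x
    using card_fibre_critical[OF cop m(1) m1, of x] that by (simp add: C_def)
  let ?h = "\<lambda>x. p - smult (v x) q"
  have pp: "Some (v x) = proj_point (v x) 1" "?h x = pencil p q (v x) 1" for x
    by (simp_all add: proj_point_def pencil_def)
  have h0: "?h x \<noteq> 0" for x
    using pencil_nonzero[OF cop m(1) _ m1, of "v x" 1] by (simp add: pp)
  have cm: "coeff (?h x) m \<noteq> 0" if "x \<in> C" for x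
  proof
    assume "coeff (?h x) m = 0"
    then have "None \<in> rat_map p q -` {Some (v x)}"
      using rat_map_fibre[OF cop m(1), of "v x" 1] by (simp flip: pp)
    then show False using cv[OF that] inf by simp
  qed
  have deg: "degree (?h x) = m" if "x \<in> C" for x
    using degree_pencil_le[of p q "v x" 1] cm[OF that] m(1) le_degree
    by (metis order_antisym pp(2))
  have card: "card {z. poly (?h x) z = 0} \<ge> m - 1" if "x \<in> C" for x
    using simple[of "Some (v x)"] card_rat_map_fibre(2)[OF cop m(1) _ m1, of "v x" 1] cm[OF that]
    by (simp flip: pp)
  have dbl: "[:-x, 1:]\<^sup>2 dvd ?h x" if "x \<in> C" for x
  proof (rule double_root_dvd)
    show "poly (?h x) x = 0" using q[OF that] by (simp add: v_def)
    have "poly (pderiv p) x * poly q x = poly p x * poly (pderiv q) x"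
      using that by (simp add: C_def wronskian_def)
    then show "poly (pderiv (?h x)) x = 0"
      using q[OF that] by (simp add: v_def pderiv_diff pderiv_smult field_simps)
  qed
  show ex: "\<exists>L. ?h x = [:-x, 1:]\<^sup>2 * L \<and> poly L x \<noteq> 0" if x: "x \<in> C" for x
  proof -
    obtain L where L: "?h x = [:-x, 1:]\<^sup>2 * L" using dbl[OF x] by blast
    then have "L \<noteq> 0" using h0[of x] by auto
    have dL: "degree L = m - 2"
      using deg[OF x] \<open>L \<noteq> 0\<close> by (simp add: L degree_mult_eq degree_power_eq)
    have "poly L x \<noteq> 0"
    proof
      assume "poly L x = 0"
      then have "{z. poly (?h x) z = 0} = {z. poly L z = 0}" by (auto simp: L)
      then have "card {z. poly (?h x) z = 0} \<le> m - 2"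
        using card_poly_roots_bound[OF \<open>L \<noteq> 0\<close>] dL by simp
      then show False using card[OF x] m by simp
    qed
    then show ?thesis using L by blast
  qed
  show "inj_on v C"
  proof (rule inj_onI, rule ccontr)
    fix x y assume xy: "x \<in> C" "y \<in> C" "v x = v y" "x \<noteq> y"
    have "coprime ([:-x, 1:]\<^sup>2) ([:-y, 1:]\<^sup>2)"
      using xy by (auto simp: coprime_complex_poly_iff)
    then have "[:-x, 1:]\<^sup>2 * [:-y, 1:]\<^sup>2 dvd ?h x"
      using dbl[of x] dbl[of y] xy by (intro divides_mult) simp_all
    then obtain L where L: "?h x = [:-x, 1:]\<^sup>2 * [:-y, 1:]\<^sup>2 * L" by blast
    then have "L \<noteq> 0" using h0[of x] by auto
    then have dL: "m = 4 + degree L"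
      using deg[OF xy(1)] unfolding L by (simp add: degree_mult_eq degree_power_eq)
    have "{z. poly (?h x) z = 0} \<subseteq> {x, y} \<union> {z. poly L z = 0}" by (auto simp: L)
    then have "card {z. poly (?h x) z = 0} \<le> card ({x, y} \<union> {z. poly L z = 0})"
      using \<open>L \<noteq> 0\<close> by (intro card_mono) (auto simp: poly_roots_finite)
    also have "\<dots> \<le> card {x, y} + card {z. poly L z = 0}" by (rule card_Un_le)
    also have "\<dots> \<le> 2 + degree L"
      using card_poly_roots_bound[OF \<open>L \<noteq> 0\<close>] xy(4) by simp
    finally show False using card[OF xy(1)] dL by simp
  qed
  \<comment> \<open>Up to sign this is the coefficient of degree \<open>m - 1\<close> in the member
    of the pencil vanishing at infinity. That member has \<open>m - 1\<close> finite roots.\<close>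
  have "coeff (wronskian p q) (2 * m - 2) \<noteq> 0"
  proof -
    let ?k = "pencil p q (coeff p m) (coeff q m)"
    note nz = rat_map_coords(2)[OF cop m(1)]
    have k0: "?k \<noteq> 0" using pencil_nonzero[OF cop m(1) nz m1] .
    have k: "coeff ?k m = 0" by (simp add: pencil_def)
    then have "card {z. poly ?k z = 0} + 1 = m"
      using inf(2) card_rat_map_fibre(2)[OF cop m(1) nz m1] by (simp add: rat_map_None[OF m(1)])
    then have "m - 1 \<le> degree ?k" using card_poly_roots_bound[OF k0] by simp
    moreover have "degree ?k < m"
      using degree_pencil_le[of p q "coeff p m" "coeff q m"] k k0 m(1)
      by (metis leading_coeff_0_iff order_le_less)
    ultimately have "degree ?k = m - 1" by simp
    then have "coeff ?k (m - 1) \<noteq> 0" using k0 by (metis leading_coeff_0_iff)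
    then show ?thesis
      using coeff_wronskian[of p m q] m by (simp add: pencil_def mult.commute)
  qed
  then have W: "wronskian p q \<noteq> 0" "degree (wronskian p q) = 2 * m - 2"
    using degree_wronskian_le[of p m q] m by (auto intro!: order_antisym le_degree)
  have "poly (pderiv (wronskian p q)) x \<noteq> 0" if x: "x \<in> C" for x
  proof -
    obtain L where L: "?h x = [:-x, 1:]\<^sup>2 * L" "poly L x \<noteq> 0" using ex[OF x] by blast
    have "wronskian p q = wronskian (?h x) q" by (simp add: wronskian_diff_smult)
    also have "poly (pderiv (wronskian (?h x) q)) x = 2 * poly L x * poly q x"
      unfolding L wronskian_def power2_eq_square
      by (simp add: pderiv_mult pderiv_diff pderiv_add pderiv_pCons del: mult_pCons_left mult_pCons_right)
    finally show ?thesis using L q[OF x] by simp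
  qed
  then show "card C = 2 * m - 2"
    using card_roots_no_double_root[OF W(1)] W(2) by (simp add: C_def)
qed

section \<open>Adjoint polynomials vanish on the parametrised curve\<close>

text \<open>Here \<open>S\<close> has at most a simple zero at \<open>g\<^sub>1 / g\<^sub>2\<close>, so the order on the left is the local degree of \<open>g\<^sub>1 / g\<^sub>2\<close> at \<open>t\<close>.\<close>

lemma order_hom_subst_le_wronskian:
  assumes cop: "coprime g1 g2" and pos: "0 < max (degree g1) (degree g2)"
    and S: "squarefree S" and root: "poly (hom_subst (degree S) S g1 g2) t = 0"
  shows "order t (hom_subst (degree S) S g1 g2) \<le> order t (wronskian g1 g2) + 1"
proof -
  have S0: "S \<noteq> 0" using S by auto
  \<comment> \<open>\<open>S\<close> is homogenised to its exact degree, so the form does not vanish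
    at infinity.\<close>
  have g2t: "poly g2 t \<noteq> 0"
  proof
    assume g2: "poly g2 t = 0"
    then have "lead_coeff S * poly g1 t ^ degree S = 0"
      using root by (simp add: poly_hom_subst hom_eval_infinity)
    then show False using S0 g2 cop by (auto simp: coprime_complex_poly_iff)
  qed
  define y where "y = poly g1 t / poly g2 t"
  have "poly S y = 0"
    using root g2t by (simp add: poly_hom_subst hom_eval_finite y_def)
  then obtain S' where S': "S = [:-y, 1:] * S'" by (auto simp: poly_eq_0_iff_dvd)
  have "poly S' y \<noteq> 0"
  proof
    assume "poly S' y = 0"
    then obtain r where r: "S' = [:-y, 1:] * r" by (auto simp: poly_eq_0_iff_dvd)
    have "S = [:-y, 1:]\<^sup>2 * r" unfolding S' r by (simp only: power2_eq_square mult.assoc)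
    then have "[:-y, 1:]\<^sup>2 dvd S" by (rule dvdI)
    from squarefreeD[OF S this] show False by (simp add: is_unit_poly_iff)
  qed
  have "S' \<noteq> 0" using S' S0 by auto
  then have dS: "degree S = 1 + degree S'" unfolding S' by (subst degree_mult_eq) auto
  define h where "h = g1 - smult y g2"
  define R where "R = hom_subst (degree S') S' g1 g2"
  have H: "hom_subst (degree S) S g1 g2 = h * R"
  proof -
    have "hom_subst (1 + degree S') ([:-y, 1:] * S') g1 g2 = hom_subst 1 [:-y, 1:] g1 g2 * R"
      unfolding R_def by (rule hom_subst_mult) simp_all
    moreover have "hom_subst 1 [:-y, 1:] g1 g2 = h" by (simp add: hom_subst_linear h_def)
    ultimately show ?thesis by (simp only: dS flip: S')
  qed
  have Rt: "poly R t \<noteq> 0"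
    using \<open>poly S' y \<noteq> 0\<close> g2t by (simp add: R_def poly_hom_subst hom_eval_finite y_def)
  have W: "wronskian g1 g2 \<noteq> 0" using wronskian_nonzero[OF cop pos] .
  have Wh: "wronskian g1 g2 = pderiv h * g2 - h * pderiv g2"
    using wronskian_diff_smult[of g1 y g2] by (simp add: h_def wronskian_def)
  then have h0: "h \<noteq> 0" using W by auto
  have ht: "poly h t = 0" using g2t by (simp add: h_def y_def)
  have "R \<noteq> 0" using Rt by auto
  then have ord: "order t (h * R) = order t h" using h0 Rt by (simp add: order_mult order_0I)
  have "order t h \<noteq> 0" using ht h0 by (simp add: order_root)
  then obtain e where e: "order t h = Suc e" using not0_implies_Suc by blast
  have d: "[:-t, 1:] ^ Suc e dvd h" using e by (simp only: order_divides) simp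
  then have d': "[:-t, 1:] ^ e dvd h" by (meson dvd_trans le_imp_power_dvd lessI less_imp_le)
  obtain r where r: "h = [:-t, 1:] ^ Suc e * r" using d by blast
  \<comment> \<open>Only one factor is lost in the derivative, so the Wronskian
    \<open>pderiv h * g2 - h * pderiv g2\<close> keeps the power \<open>e\<close>.\<close>
  have "pderiv h = [:-t, 1:] ^ Suc e * pderiv r
      + r * (smult (of_nat (Suc e)) ([:-t, 1:] ^ e) * pderiv [:-t, 1:])"
    by (simp only: r pderiv_mult pderiv_power_Suc)
  moreover have "[:-t, 1:] ^ e dvd [:-t, 1:] ^ Suc e * pderiv r"
    by (intro dvd_mult2 le_imp_power_dvd) simp
  moreover have "[:-t, 1:] ^ e dvd r * (smult (of_nat (Suc e)) ([:-t, 1:] ^ e) * pderiv [:-t, 1:])"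
    by (intro dvd_mult dvd_mult2 dvd_smult dvd_refl)
  ultimately have "[:-t, 1:] ^ e dvd pderiv h" by (metis dvd_add)
  then have "[:-t, 1:] ^ e dvd wronskian g1 g2" using d' Wh by (simp add: dvd_diff dvd_mult2)
  then have "e \<le> order t (wronskian g1 g2)" using W by (simp add: order_divides)
  then show ?thesis using ord e H by simp
qed

text \<open>At a zero of \<open>u\<close> the factor \<open>L\<close> is nonzero, so twice the order
  of \<open>u\<close> is twice that of \<open>D\<close> plus that of the substituted
  \<open>S\<close>, which \<open>order_hom_subst_le_wronskian\<close> bounds.\<close>

lemma dvd_mult_wronskian:
  assumes cop: "coprime g1 g2" and pos: "0 < max (degree g1) (degree g2)"
    and S: "squarefree S" and u: "u \<noteq> 0" and D: "D \<noteq> 0"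
    and eq: "u\<^sup>2 * L = D\<^sup>2 * hom_subst (degree S) S g1 g2" and uL: "coprime u L"
  shows "u dvd D * wronskian g1 g2"
proof -
  let ?W = "wronskian g1 g2" and ?H = "hom_subst (degree S) S g1 g2"
  have W: "?W \<noteq> 0" using wronskian_nonzero[OF cop pos] .
  have H: "?H \<noteq> 0" using S by (intro hom_subst_nonzero[OF cop pos]) auto
  then have L: "L \<noteq> 0" using eq D by auto
  show ?thesis
  proof (rule dvd_by_order)
    fix t
    have "order t (u\<^sup>2 * L) = order t (D\<^sup>2 * ?H)" by (simp only: eq)
    then have ord: "2 * order t u + order t L = 2 * order t D + order t ?H"
      using u D L H by (simp add: power2_eq_square order_mult)
    have DW: "order t (D * ?W) = order t D + order t ?W" using D W by (simp add: order_mult)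
    show "order t u \<le> order t (D * ?W)"
    proof (cases "poly u t = 0")
      case True
      then have "order t L = 0" using uL by (auto simp: coprime_complex_poly_iff intro!: order_0I)
      moreover have "order t ?H = 0 \<or> order t ?H \<le> order t ?W + 1"
        using order_hom_subst_le_wronskian[OF cop pos S, of t] order_0I by blast
      \<comment> \<open>The surplus \<open>1\<close> in the bound on \<open>?H\<close> matters only
        if \<open>?W\<close> has order \<open>0\<close>; there parity removes it.\<close>
      ultimately show ?thesis using ord DW by linarith
    next
      case False
      then show ?thesis by (simp add: order_0I)
    qed
  qed (use u D W in auto)
qed

text \<open>
  The equation \<open>F \<circ> Y = X \<circ> G\<close> in homogeneous coordinates, for \<open>F = p / q\<close>, \<open>X = a / b\<close>, \<open>Y = y\<^sub>1 / y\<^sub>2\<close> and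
  \<open>G = g\<^sub>1 / g\<^sub>2\<close>, where \<open>C\<close> is the set of critical points of \<open>F\<close> and \<open>v\<close> is \<open>F\<close> restricted to \<open>C\<close>. The assumptions
  \<open>X_inf\<close> and \<open>Y_inf\<close> say that \<open>X(\<infinity>)\<close> is not a critical value and \<open>Y(\<infinity>)\<close> not a critical point of \<open>F\<close>.
\<close>

locale composition_equation =
  fixes p q a b y1 y2 g1 g2 :: "complex poly" and m n k l :: nat
    and C :: "complex set" and v :: "complex \<Rightarrow> complex"
  assumes m: "degree p \<le> m" "degree q \<le> m" "m \<ge> 4"
    and C: "card C = 2 * m - 2" "inj_on v C"
    and double: "\<And>x. x \<in> C \<Longrightarrow> \<exists>L. p - smult (v x) q = [:-x, 1:]\<^sup>2 * L \<and> poly L x \<noteq> 0"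
    and ab: "coprime a b" "n = max (degree a) (degree b)" "n \<ge> 2"
    and X_inf: "\<And>x. x \<in> C \<Longrightarrow> degree (a - smult (v x) b) = n"
    and y: "coprime y1 y2" "k = max (degree y1) (degree y2)" "k \<ge> 1"
    and Y_inf: "\<And>x. x \<in> C \<Longrightarrow> degree (y1 - smult x y2) = k"
    and g: "coprime g1 g2" "l = max (degree g1) (degree g2)" "l \<ge> 1"
    and nz: "y2 \<noteq> 0" "g2 \<noteq> 0"
    and degrees: "m * k = n * l"
    and eq: "hom_subst m p y1 y2 = hom_subst n a g1 g2" "hom_subst m q y1 y2 = hom_subst n b g1 g2"
begin

lemma finite_C: "finite C"
  using C m by (intro card_ge_0_finite) simp

text \<open>
  At a point \<open>(x, y)\<close> with \<open>x \<in> C\<close> and \<open>X - v x\<close> vanishing to order \<open>e\<close> at \<open>y\<close>, the curve looks like \<open>s\<^sup>2 = t\<^sup>e\<close> and has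
  adjoint ideal \<open>(s, t\<^bsup>\<lfloor>e/2\<rfloor>\<^esup>)\<close>. So \<open>A\<close> is adjoint if and only if \<open>D x\<close> divides \<open>A(x, \<cdot>)\<close> for all \<open>x \<in> C\<close>.
\<close>

definition D where "D x = square_part (a - smult (v x) b)"

lemma D_nonzero:
  assumes "x \<in> C"
  shows "D x \<noteq> 0"
proof -
  have "degree (a - smult (v x) b) \<noteq> 0" using X_inf[OF assms] ab(3) by linarith
  then have "a - smult (v x) b \<noteq> 0" by (metis degree_0)
  then show ?thesis by (simp add: D_def)
qed

lemma D_dvd_wronskian: "D x dvd wronskian a b"
  using dvd_wronskian_if_square_dvd[of "D x" "a - smult (v x) b" b]
  by (simp add: D_def wronskian_diff_smult)

lemma D_coprime:
  assumes "x \<in> C" "x' \<in> C" "x \<noteq> x'"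
  shows "coprime (D x) (D x')"
proof -
  have "v x \<noteq> v x'" using assms C by (auto dest: inj_onD)
  then have "coprime (a - smult (v x) b) (a - smult (v x') b)"
    using ab(1) by (fastforce simp: coprime_complex_poly_iff)
  moreover have "D z dvd a - smult (v z) b" for z
    unfolding D_def by (metis dvd_power dvd_trans pos2 square_part_square_dvd)
  ultimately show ?thesis using coprime_divisors by blast
qed

text \<open>The \<open>D x\<close> are pairwise coprime and divide the Wronskian of \<open>a\<close>
  and \<open>b\<close>; the degree of their product counts the adjoint conditions.\<close>

lemma prod_D: "prod D C \<noteq> 0" "degree (prod D C) \<le> 2 * n - 2"
proof -
  show "prod D C \<noteq> 0" using D_nonzero finite_C by simp
  have "prod D C dvd wronskian a b"
    using finite_C D_coprime D_dvd_wronskian by (intro prod_dvd_if_pairwise_coprime) auto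
  moreover have "wronskian a b \<noteq> 0" using wronskian_nonzero[OF ab(1)] ab by simp
  ultimately have "degree (prod D C) \<le> degree (wronskian a b)" by (rule dvd_imp_degree_le)
  also have "\<dots> \<le> 2 * n - 2" using degree_wronskian_le[of a n b] ab by simp
  finally show "degree (prod D C) \<le> 2 * n - 2" .
qed

section \<open>Denominator and numerator of the pulled back differential form\<close>

definition u where "u x = y1 - smult x y2"

lemma u_nonzero:
  assumes "x \<in> C"
  shows "u x \<noteq> 0"
proof -
  have "degree (u x) \<noteq> 0" using Y_inf[OF assms] y(3) by (simp add: u_def)
  then show ?thesis by (metis degree_0)
qed

text \<open>Substituting \<open>F - v x = (z - x)^2 L\<close> and \<open>X - v x = (D x)^2 S\<close>
  into \<open>F \<circ> Y = X \<circ> G\<close> gives the identity required by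
  \<open>dvd_mult_wronskian\<close>. The substituted \<open>L\<close> is coprime to
  \<open>u x\<close> because \<open>L\<close> is nonzero at \<open>x\<close>.\<close>

lemma u_dvd:
  assumes x: "x \<in> C"
  shows "u x dvd hom_subst (degree (D x)) (D x) g1 g2 * wronskian g1 g2"
proof -
  let ?r = "a - smult (v x) b"
  define S where "S = squarefree_part ?r"
  have r: "?r = D x * (D x * S)"
    using squarefree_decompose[of ?r] unfolding S_def D_def power2_eq_square by (simp add: mult_ac)
  have "S \<noteq> 0" by (simp add: S_def)
  \<comment> \<open>By \<open>X_inf\<close> the formal degree \<open>n\<close> is the true degree
    and splits along the factorisation.\<close>
  have n: "n = degree (D x) + (degree (D x) + degree S)"
    using X_inf[OF x] D_nonzero[OF x] \<open>S \<noteq> 0\<close> by (simp add: r degree_mult_eq)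
  obtain L where L: "p - smult (v x) q = [:-x, 1:]\<^sup>2 * L" "poly L x \<noteq> 0" using double[OF x] by blast
  have "L \<noteq> 0" using L by auto
  have "degree (p - smult (v x) q) \<le> m"
    using m degree_smult_le[of "v x" q] by (intro degree_diff_le) auto
  then have dL: "degree L \<le> m - 2"
    using \<open>L \<noteq> 0\<close> by (simp add: L degree_mult_eq degree_power_eq)
  have "hom_subst m (p - smult (v x) q) y1 y2 = hom_subst n ?r g1 g2"
    by (simp only: hom_subst_diff hom_subst_smult eq)
  also have "hom_subst n ?r g1 g2
      = (hom_subst (degree (D x)) (D x) g1 g2)\<^sup>2 * hom_subst (degree S) S g1 g2"
    unfolding r n by (simp add: hom_subst_mult degree_mult_le power2_eq_square)
  also have "hom_subst m (p - smult (v x) q) y1 y2 = (u x)\<^sup>2 * hom_subst (m - 2) L y1 y2"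
  proof -
    have "hom_subst (1 + (1 + (m - 2))) ([:-x, 1:] * ([:-x, 1:] * L)) y1 y2
        = hom_subst 1 [:-x, 1:] y1 y2 * (hom_subst 1 [:-x, 1:] y1 y2 * hom_subst (m - 2) L y1 y2)"
    proof (subst hom_subst_mult)
      show "degree ([:-x, 1:] * L) \<le> 1 + (m - 2)"
        using degree_mult_le[of "[:-x, 1:]" L] dL by simp
      show "hom_subst 1 [:- x, 1:] y1 y2 * hom_subst (1 + (m - 2)) ([:- x, 1:] * L) y1 y2
        = hom_subst 1 [:- x, 1:] y1 y2 * (hom_subst 1 [:- x, 1:] y1 y2 * hom_subst (m - 2) L y1 y2)"
        by (subst hom_subst_mult) (use dL in simp_all)
    qed simp
    moreover have "1 + (1 + (m - 2)) = m" using m by simp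
    moreover have "hom_subst 1 [:-x, 1:] y1 y2 = u x"
      by (simp add: hom_subst_linear u_def)
    ultimately show ?thesis by (simp only: L power2_eq_square mult.assoc)
  qed
  finally have main: "(u x)\<^sup>2 * hom_subst (m - 2) L y1 y2
    = (hom_subst (degree (D x)) (D x) g1 g2)\<^sup>2 * hom_subst (degree S) S g1 g2" .
  have "coprime (u x) (hom_subst (m - 2) L y1 y2)"
    unfolding coprime_complex_poly_iff
  proof (intro allI notI)
    fix t assume t: "poly (u x) t = 0 \<and> poly (hom_subst (m - 2) L y1 y2) t = 0"
    then have y1t: "poly y1 t = x * poly y2 t" by (simp add: u_def)
    then have y2t: "poly y2 t \<noteq> 0" using y(1) by (auto simp: coprime_complex_poly_iff)
    then have "poly L x = 0" using t dL by (simp add: poly_hom_subst hom_eval_finite y1t)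
    then show False using L by simp
  qed
  moreover note u_nonzero[OF x]
  moreover have "hom_subst (degree (D x)) (D x) g1 g2 \<noteq> 0"
    using g D_nonzero[OF x] by (intro hom_subst_nonzero) auto
  moreover have "squarefree S" by (simp add: S_def)
  ultimately show ?thesis using g main by (intro dvd_mult_wronskian[of g1 g2 S]) auto
qed

text \<open>This is \<open>A(Y, G)\<close> for \<open>A = A0 + A1 x + A2 x^2\<close>, multiplied by
  \<open>y2 ^ 2 * g2 ^ (n - 2)\<close> to clear denominators.\<close>

definition \<Theta> where
  "\<Theta> A0 A1 A2 = y2\<^sup>2 * hom_subst (n - 2) A0 g1 g2 + y1 * y2 * hom_subst (n - 2) A1 g1 g2
     + y1\<^sup>2 * hom_subst (n - 2) A2 g1 g2"

text \<open>
  The product of all \<open>u x\<close> is the denominator of the pulled back differential form. It divides the numerator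
  \<open>\<Theta> * wronskian g1 g2\<close>, which has smaller degree because \<open>m \<ge> 4\<close>.
\<close>

lemma adjoint_vanishes:
  assumes deg: "degree A0 \<le> n - 2" "degree A1 \<le> n - 2" "degree A2 \<le> n - 2"
    and adj: "\<And>x. x \<in> C \<Longrightarrow> D x dvd A0 + smult x A1 + smult (x\<^sup>2) A2"
  shows "\<Theta> A0 A1 A2 = 0"
proof (rule ccontr)
  assume T0: "\<Theta> A0 A1 A2 \<noteq> 0"
  let ?T = "\<Theta> A0 A1 A2" and ?W = "wronskian g1 g2"
  have W: "?W \<noteq> 0" using wronskian_nonzero[OF g(1)] g by simp
  have dvd: "u x dvd ?T * ?W" if x: "x \<in> C" for x
  proof -
    let ?B = "A0 + smult x A1 + smult (x\<^sup>2) A2"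
    have dB: "degree ?B \<le> n - 2"
      using deg by (intro degree_add_le) (auto intro: order_trans[OF degree_smult_le])
    obtain E where E: "?B = D x * E" using adj[OF x] by blast
    have "hom_subst (degree (D x)) (D x) g1 g2 dvd hom_subst (n - 2) ?B g1 g2"
    proof (cases "E = 0")
      case True
      then show ?thesis by (simp add: E)
    next
      case False
      then have "degree (D x) + degree E \<le> n - 2"
        using dB D_nonzero[OF x] by (simp add: E degree_mult_eq)
      then have "hom_subst (degree (D x) + (n - 2 - degree (D x))) (D x * E) g1 g2
          = hom_subst (degree (D x)) (D x) g1 g2 * hom_subst (n - 2 - degree (D x)) E g1 g2"
        by (intro hom_subst_mult) auto
      moreover have "degree (D x) + (n - 2 - degree (D x)) = n - 2"
        using \<open>degree (D x) + degree E \<le> n - 2\<close> by linarith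
      ultimately show ?thesis by (metis E dvd_triv_left)
    qed
    then have "u x dvd hom_subst (n - 2) ?B g1 g2 * ?W"
      using u_dvd[OF x] by (meson dvd_refl dvd_trans mult_dvd_mono)
    \<comment> \<open>Modulo \<open>u x\<close> one may replace \<open>y1\<close> by
      \<open>x * y2\<close>, which turns \<open>?T\<close> into \<open>A(x, G)\<close> up to
      clearing denominators.\<close>
    moreover have "?T = y2\<^sup>2 * hom_subst (n - 2) ?B g1 g2
        + u x * (y2 * hom_subst (n - 2) A1 g1 g2 + (y1 + smult x y2) * hom_subst (n - 2) A2 g1 g2)"
      by (simp add: \<Theta>_def u_def hom_subst_add hom_subst_smult algebra_simps power2_eq_square
        smult_diff_right)
    ultimately show ?thesis
      by (simp only: distrib_right mult.assoc dvd_add dvd_mult dvd_triv_left)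
  qed
  have "prod u C dvd ?T * ?W"
  proof (rule prod_dvd_if_pairwise_coprime[OF finite_C dvd])
    fix x x' assume xx: "x \<in> C" "x' \<in> C" "x \<noteq> x'"
    show "coprime (u x) (u x')"
      unfolding coprime_complex_poly_iff
    proof (intro allI notI)
      fix t assume "poly (u x) t = 0 \<and> poly (u x') t = 0"
      then have "poly y1 t = x * poly y2 t" "x * poly y2 t = x' * poly y2 t" by (auto simp: u_def)
      then show False using xx(3) y(1) by (auto simp: coprime_complex_poly_iff)
    qed
  qed
  then have "degree (prod u C) \<le> degree (?T * ?W)"
    using T0 W by (intro dvd_imp_degree_le) auto
  moreover have "degree (prod u C) = (2 * m - 2) * k"
  proof -
    have "degree (prod u C) = (\<Sum>x\<in>C. degree (u x))"
      using u_nonzero by (intro degree_prod_eq_sum_degree) auto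
    also have "\<dots> = (\<Sum>x\<in>C. k)" using Y_inf by (simp add: u_def)
    finally show ?thesis by (simp add: C)
  qed
  moreover have "degree ?T \<le> 2 * k + (n - 2) * l"
  proof -
    have h: "degree (hom_subst (n - 2) A g1 g2) \<le> (n - 2) * l" for A
      using g by (intro degree_hom_subst_le) auto
    have yy: "degree y1 \<le> k" "degree y2 \<le> k" using y by auto
    have "degree (s * t * hom_subst (n - 2) A g1 g2) \<le> 2 * k + (n - 2) * l"
      if "degree s \<le> k" "degree t \<le> k" for s t A
      using degree_mult_le[of s t] degree_mult_le[of "s * t" "hom_subst (n - 2) A g1 g2"] h[of A] that
      by linarith
    then show ?thesis
      unfolding \<Theta>_def power2_eq_square using yy by (intro degree_add_le) auto
  qed
  moreover have "degree ?W \<le> 2 * l - 2" using degree_wronskian_le[of g1 l g2] g by simp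
  moreover have "degree (?T * ?W) \<le> degree ?T + degree ?W" by (rule degree_mult_le)
  \<comment> \<open>With \<open>m * k = n * l\<close> the right side becomes
    \<open>2 * k + m * k - 2\<close>, and \<open>m \<ge> 4\<close> amounts to
    \<open>m + 2 \<le> 2 * m - 2\<close>.\<close>
  ultimately have "(2 * m - 2) * k \<le> 2 * k + (n - 2) * l + (2 * l - 2)" by linarith
  also have "\<dots> = 2 * k + m * k - 2"
  proof -
    obtain n' l' where "n = n' + 2" "l = l' + 1" using ab g by (metis add.commute le_Suc_ex)
    then show ?thesis using degrees by simp
  qed
  also have "\<dots> < (m + 2) * k" using y by (simp add: algebra_simps)
  also have "\<dots> \<le> (2 * m - 2) * k" using m by (intro mult_right_mono) auto
  finally show False by simp
qed

text \<open>There are \<open>2n - 1\<close> coefficients and at most \<open>2n - 2\<close> linear conditions.\<close>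

lemma adjoint_exists:
  assumes j: "j \<le> n - 2"
  obtains A0 A1 c where "degree A0 \<le> n - 2" "degree A1 \<le> n - 2"
    "A0 \<noteq> 0 \<or> A1 \<noteq> 0 \<or> c \<noteq> 0" "\<Theta> A0 A1 (monom c j) = 0"
proof -
  \<comment> \<open>As \<open>\<xi>\<close> interpolates \<open>x\<close> modulo every
    \<open>D x\<close>, all adjoint conditions merge into one congruence
    \<open>A0 + A1 \<xi> + A2 \<xi>^2 = 0\<close> modulo the product \<open>P\<close>.\<close>
  obtain \<xi> where \<xi>: "\<And>x. x \<in> C \<Longrightarrow> D x dvd \<xi> - [:x:]"
    using chinese_remainder_family[OF finite_C, of D "\<lambda>x. [:x:]"] D_coprime by blast
  define P where "P = prod D C"
  have P: "P \<noteq> 0" "degree P \<le> 2 * n - 2" using prod_D by (simp_all add: P_def)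
  \<comment> \<open>The index \<open>(e, i)\<close> stands for the monomial \<open>x^e y^i\<close>;
    there are \<open>2 * (n - 1) + 1\<close> of them.\<close>
  define I where "I = {0, 1} \<times> {..<n - 1} \<union> {(2 :: nat, j)}"
  have fin: "finite I" by (simp add: I_def)
  have "({0, 1} \<times> {..<n - 1}) \<inter> {(2 :: nat, j)} = {}" by auto
  then have cardI: "2 * n - 2 < card I"
    unfolding I_def by (subst card_Un_disjoint) (use ab in \<open>auto simp: card_cartesian_product\<close>)
  define h where "h = (\<lambda>(e, i). \<xi> ^ e * monom 1 i)"
  have "h i mod P = 0 \<or> degree (h i mod P) < 2 * n - 2" for i
    using degree_mod_less[OF P(1), of "h i"] P(2) by linarith
  then obtain c where c: "\<exists>i\<in>I. c i \<noteq> 0" "(\<Sum>i\<in>I. smult (c i) (h i mod P)) = 0"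
    using poly_family_dependent[OF fin cardI, of "\<lambda>i. h i mod P"] by blast
  define A where "A e = (\<Sum>i<n - 1. monom (c (e, i)) i)" for e
  have degA: "degree (A e) \<le> n - 2" for e
    unfolding A_def
  proof (rule degree_sum_le)
    fix i assume "i \<in> {..<n - 1}"
    then have "i \<le> n - 2" by auto
    then show "degree (monom (c (e, i)) i) \<le> n - 2" using degree_monom_le order_trans by blast
  qed simp
  have coeffA: "coeff (A e) i = c (e, i)" if "i < n - 1" for e i
    using that by (simp add: A_def coeff_sum)
  have "(\<Sum>i\<in>I. smult (c i) (h i)) = A 0 + \<xi> * A 1 + \<xi>\<^sup>2 * monom (c (2, j)) j"
  proof -
    have "(\<Sum>i\<in>I. smult (c i) (h i))
        = (\<Sum>i\<in>{0, 1} \<times> {..<n - 1}. smult (c i) (h i)) + smult (c (2, j)) (h (2, j))"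
      unfolding I_def by (subst sum.union_disjoint) auto
    also have "(\<Sum>i\<in>{0, 1} \<times> {..<n - 1}. smult (c i) (h i))
        = (\<Sum>e\<in>{0, 1}. \<Sum>i<n - 1. smult (c (e, i)) (h (e, i)))"
      by (simp add: sum.cartesian_product)
    finally show ?thesis
      by (simp add: h_def A_def sum_distrib_left smult_monom flip: mult_smult_right)
  qed
  moreover have "P dvd (\<Sum>i\<in>I. smult (c i) (h i))"
  proof -
    have "P dvd (\<Sum>i\<in>I. smult (c i) (h i - h i mod P))"
      by (intro dvd_sum dvd_smult dvd_minus_mod)
    then show ?thesis using c(2) by (simp add: smult_diff_right sum_subtractf)
  qed
  ultimately have PA: "P dvd A 0 + \<xi> * A 1 + \<xi>\<^sup>2 * monom (c (2, j)) j" by simp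
  have "\<Theta> (A 0) (A 1) (monom (c (2, j)) j) = 0"
  proof (rule adjoint_vanishes)
    show "degree (monom (c (2, j)) j) \<le> n - 2" using j degree_monom_le order_trans by blast
    fix x assume x: "x \<in> C"
    have "D x dvd P" using x finite_C by (auto simp: P_def)
    then have "D x dvd A 0 + \<xi> * A 1 + \<xi>\<^sup>2 * monom (c (2, j)) j" using PA dvd_trans by blast
    \<comment> \<open>The difference of the values of \<open>A\<close> at \<open>\<xi>\<close> and
      at \<open>x\<close> is divisible by \<open>\<xi> - x\<close>.\<close>
    moreover have "A 0 + smult x (A 1) + smult (x\<^sup>2) (monom (c (2, j)) j)
      = A 0 + \<xi> * A 1 + \<xi>\<^sup>2 * monom (c (2, j)) j
        - (\<xi> - [:x:]) * (A 1 + (\<xi> + [:x:]) * monom (c (2, j)) j)"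
      by (simp add: algebra_simps power2_eq_square smult_diff_right)
    ultimately show "D x dvd A 0 + smult x (A 1) + smult (x\<^sup>2) (monom (c (2, j)) j)"
      using \<xi>[OF x] by (simp only: dvd_diff dvd_mult2)
  qed (rule degA)+
  moreover have "A 0 \<noteq> 0 \<or> A 1 \<noteq> 0 \<or> c (2, j) \<noteq> 0"
    using c(1) coeffA unfolding I_def by (metis (no_types, lifting) SigmaE UnE coeff_0 insertE lessThan_iff singletonD)
  ultimately show ?thesis using that degA by blast
qed

text \<open>
  If the relations for \<open>x\<^sup>2\<close> and \<open>x\<^sup>2 y\<^sup>n\<^sup>-\<^sup>2\<close> cancel completely, then \<open>A\<^sub>0\<close> and \<open>A\<^sub>1\<close> are constants and \<open>Y\<close> is a root of
  a quadratic polynomial over the constants, which is impossible.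
\<close>

lemma linear_relation:
  obtains A0 A1 N where "A0 \<noteq> 0 \<or> A1 \<noteq> 0" "degree A0 \<le> N" "degree A1 \<le> N"
    "y2 * hom_subst N A0 g1 g2 + y1 * hom_subst N A1 g1 g2 = 0"
proof -
  obtain A0 A1 c where A: "degree A0 \<le> n - 2" "degree A1 \<le> n - 2"
    "A0 \<noteq> 0 \<or> A1 \<noteq> 0 \<or> c \<noteq> 0" "\<Theta> A0 A1 (monom c 0) = 0"
    by (rule adjoint_exists[of 0]) auto
  obtain B0 B1 d where B: "degree B0 \<le> n - 2" "degree B1 \<le> n - 2"
    "B0 \<noteq> 0 \<or> B1 \<noteq> 0 \<or> d \<noteq> 0" "\<Theta> B0 B1 (monom d (n - 2)) = 0"
    by (rule adjoint_exists[of "n - 2"]) auto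
  have linear: "y2 * hom_subst (n - 2) E0 g1 g2 + y1 * hom_subst (n - 2) E1 g1 g2 = 0"
    if "\<Theta> E0 E1 0 = 0" for E0 E1
  proof -
    have "y2 * (y2 * hom_subst (n - 2) E0 g1 g2 + y1 * hom_subst (n - 2) E1 g1 g2) = 0"
      using that by (simp add: \<Theta>_def algebra_simps power2_eq_square)
    then show ?thesis using nz by simp
  qed
  show ?thesis
  proof (cases "c = 0 \<or> d = 0")
    case True
    then show ?thesis
    proof
      assume "c = 0"
      then show ?thesis using that[OF _ A(1,2) linear] A(3,4) by simp
    next
      assume "d = 0"
      then show ?thesis using that[OF _ B(1,2) linear] B(3,4) by simp
    qed
  next
    case False
    \<comment> \<open>In \<open>d * M\<close> times the first relation minus \<open>c\<close> times
      the second, the terms \<open>c x^2\<close> and \<open>d x^2 y^(n - 2)\<close> cancel.\<close>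
    define M :: "complex poly" where "M = monom 1 (n - 2)"
    define E0 where "E0 = smult d (M * A0) - smult c B0"
    define E1 where "E1 = smult d (M * A1) - smult c B1"
    let ?N = "(n - 2) + (n - 2)"
    have dM: "degree M \<le> n - 2" by (simp add: M_def degree_monom_le)
    have dE: "degree (smult d (M * A) - smult c B) \<le> ?N"
      if "degree A \<le> n - 2" "degree B \<le> n - 2" for A B
    proof (rule degree_diff_le)
      show "degree (smult d (M * A)) \<le> ?N"
        using degree_smult_le[of d "M * A"] degree_mult_le[of M A] dM that by linarith
      show "degree (smult c B) \<le> ?N"
        using degree_smult_le[of c B] that by linarith
    qed
    have hE: "hom_subst ?N (smult d (M * A) - smult c B) g1 g2
        = smult d (g1 ^ (n - 2) * hom_subst (n - 2) A g1 g2) - smult c (g2 ^ (n - 2) * hom_subst (n - 2) B g1 g2)"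
      if "degree A \<le> n - 2" "degree B \<le> n - 2" for A B
    proof -
      have "hom_subst ?N (M * A) g1 g2 = g1 ^ (n - 2) * hom_subst (n - 2) A g1 g2"
        using that dM by (simp only: hom_subst_mult) (simp add: M_def hom_subst_monom)
      \<comment> \<open>Here \<open>monom 1 0\<close> is the constant 1 read as a form of degree
        \<open>n - 2\<close>, which pads the formal degree by \<open>g2 ^ (n - 2)\<close>.\<close>
      moreover have "hom_subst ?N (monom 1 0 * B) g1 g2 = g2 ^ (n - 2) * hom_subst (n - 2) B g1 g2"
        using that hom_subst_monom[of 0 "n - 2" 1 g1 g2] by (subst hom_subst_mult) simp_all
      ultimately show ?thesis by (simp add: hom_subst_diff hom_subst_smult monom_0)
    qed
    have TA: "y2\<^sup>2 * hom_subst (n - 2) A0 g1 g2 + y1 * y2 * hom_subst (n - 2) A1 g1 g2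
        + y1\<^sup>2 * smult c (g2 ^ (n - 2)) = 0"
      using A(4) by (simp add: \<Theta>_def hom_subst_monom)
    have TB: "y2\<^sup>2 * hom_subst (n - 2) B0 g1 g2 + y1 * y2 * hom_subst (n - 2) B1 g1 g2
        + y1\<^sup>2 * smult d (g1 ^ (n - 2)) = 0"
      using B(4) by (simp add: \<Theta>_def hom_subst_monom)
    have "y2 * (y2 * hom_subst ?N E0 g1 g2 + y1 * hom_subst ?N E1 g1 g2)
      = smult d (g1 ^ (n - 2)) * (y2\<^sup>2 * hom_subst (n - 2) A0 g1 g2 + y1 * y2 * hom_subst (n - 2) A1 g1 g2
        + y1\<^sup>2 * smult c (g2 ^ (n - 2)))
      - smult c (g2 ^ (n - 2)) * (y2\<^sup>2 * hom_subst (n - 2) B0 g1 g2 + y1 * y2 * hom_subst (n - 2) B1 g1 g2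
        + y1\<^sup>2 * smult d (g1 ^ (n - 2)))"
      unfolding E0_def E1_def hE[OF A(1) B(1)] hE[OF A(2) B(2)]
      by (simp add: algebra_simps power2_eq_square smult_add_right smult_diff_right)
    then have E: "y2 * hom_subst ?N E0 g1 g2 + y1 * hom_subst ?N E1 g1 g2 = 0"
      using nz TA TB by simp
    show ?thesis
    proof (cases "E0 = 0 \<and> E1 = 0")
      case False
      then show ?thesis using that[of E0 E1 ?N] E dE A B by (auto simp: E0_def E1_def)
    next
      case True
      \<comment> \<open>The degree bound on \<open>B'\<close> leaves no room for a nonconstant
        \<open>A'\<close> beside \<open>M\<close>, which has degree \<open>n - 2\<close>.\<close>
      have const: "degree A' = 0" if "smult d (M * A') = smult c B'" "degree B' \<le> n - 2" for A' B'
      proof (cases "A' = 0")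
        case False
        then have "degree (smult d (M * A')) = n - 2 + degree A'"
          using \<open>\<not> (c = 0 \<or> d = 0)\<close> by (simp add: degree_mult_eq M_def degree_monom_eq)
        moreover have "degree (smult c B') \<le> n - 2" using degree_smult_le[of c B'] that by linarith
        ultimately show ?thesis using that by simp
      qed simp
      have "degree A0 = 0" "degree A1 = 0"
        using True B const[of A0 B0] const[of A1 B1] by (simp_all add: E0_def E1_def)
      then obtain \<alpha> \<beta> where \<alpha>\<beta>: "A0 = monom \<alpha> 0" "A1 = monom \<beta> 0"
        by (metis degree_eq_zeroE monom_0)
      have "g2 ^ (n - 2) * hom_subst 2 [:\<alpha>, \<beta>, c:] y1 y2 = 0"
      proof -
        have "hom_subst 2 [:\<alpha>, \<beta>, c:] y1 y2 = smult \<alpha> (y2\<^sup>2) + smult \<beta> (y1 * y2) + smult c (y1\<^sup>2)"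
          by (simp add: hom_subst_def numeral_2_eq_2)
        then show ?thesis
          using TA unfolding \<alpha>\<beta> by (simp add: hom_subst_monom algebra_simps)
      qed
      moreover have "hom_subst 2 [:\<alpha>, \<beta>, c:] y1 y2 \<noteq> 0"
        using y \<open>\<not> (c = 0 \<or> d = 0)\<close> by (intro hom_subst_nonzero) auto
      ultimately show ?thesis using nz by simp
    qed
  qed
qed

end

section \<open>Normalisation at infinity and descent\<close>

text \<open>The relation says \<open>Y = - A0(G) / A1(G)\<close>. Dividing by the gcd of
  \<open>A0\<close> and \<open>A1\<close> puts the left factor into lowest terms.\<close>

lemma factor_if_linear_relation:
  assumes y: "coprime y1 y2" "y2 \<noteq> 0" and g: "coprime g1 g2" "0 < max (degree g1) (degree g2)"
    and A: "A0 \<noteq> 0 \<or> A1 \<noteq> 0" "degree A0 \<le> N" "degree A1 \<le> N"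
    and rel: "y2 * hom_subst N A0 g1 g2 + y1 * hom_subst N A1 g1 g2 = 0"
  shows "\<exists>n Z. rational_function_of_degree n Z \<and> rat_map y1 y2 = Z \<circ> rat_map g1 g2"
proof -
  define d where "d = gcd A0 A1"
  have d0: "d \<noteq> 0" using A(1) by (simp add: d_def)
  then obtain a0 a1 where a: "A0 = a0 * d" "A1 = a1 * d" "coprime a0 a1"
    unfolding d_def using gcd_coprime_exists by blast
  define n where "n = max (degree a0) (degree a1)"
  have dn: "degree d + n \<le> N"
  proof -
    have "degree d + degree a0 \<le> N \<or> a0 = 0" "degree d + degree a1 \<le> N \<or> a1 = 0"
      using A d0 by (auto simp: a degree_mult_eq)
    moreover have "a0 \<noteq> 0 \<or> a1 \<noteq> 0" using A(1) a by auto
    ultimately show ?thesis by (auto simp: n_def)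
  qed
  then have N: "N = n + (N - n)" "degree d \<le> N - n" by simp_all
  define H where "H = hom_subst (N - n) d g1 g2"
  define h0 h1 where "h0 = hom_subst n a0 g1 g2" and "h1 = hom_subst n a1 g1 g2"
  have H: "H \<noteq> 0" unfolding H_def using g d0 N(2) by (intro hom_subst_nonzero) auto
  have hA: "hom_subst N (a' * d) g1 g2 = hom_subst n a' g1 g2 * H" if "degree a' \<le> n" for a'
    using hom_subst_mult[OF that N(2)] N(1) by (simp add: H_def)
  have "H * (y2 * h0 + y1 * h1) = 0"
    using rel by (simp add: a hA n_def h0_def h1_def algebra_simps)
  then have rel': "y2 * h0 + y1 * h1 = 0" using H by simp
  have a1: "a1 \<noteq> 0"
  proof
    assume "a1 = 0"
    then have "h0 = 0" using rel' y(2) by (simp add: h1_def)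
    then have "a0 = 0" unfolding h0_def using hom_subst_nonzero[OF g, of a0 n] by (auto simp: n_def)
    then show False using \<open>a1 = 0\<close> a(3) by simp
  qed
  have cop: "coprime (- a0) a1" using a(3) by simp
  have n': "n = max (degree (- a0)) (degree a1)" by (simp add: n_def)
  have neg: "hom_subst n (- a0) g1 g2 = - h0"
    using hom_subst_smult[of n "-1" a0] by (simp add: h0_def)
  have "h1 \<noteq> 0" unfolding h1_def using g a1 by (intro hom_subst_nonzero) (auto simp: n_def)
  moreover have "coprime (- h0) h1" using coprime_hom_subst[OF cop g(1) n'] neg by (simp add: h1_def)
  moreover have "y1 * h1 = - h0 * y2" using rel' by (simp add: algebra_simps add_eq_0_iff)
  ultimately have "rat_map y1 y2 = rat_map (- h0) h1" using y by (intro rat_map_eqI)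
  also have "\<dots> = rat_map (- a0) a1 \<circ> rat_map g1 g2"
    using rat_map_comp[OF cop g(1) n'] neg by (simp add: h1_def)
  finally show ?thesis
    using cop a1 n' unfolding rational_function_of_degree_def by blast
qed

lemma rational_function_of_degreeE:
  assumes "rational_function_of_degree n F"
  obtains p q where "coprime p q" "q \<noteq> 0" "n = max (degree p) (degree q)" "F = rat_map p q"
  using assms unfolding rational_function_of_degree_def by metis

lemma degree_pencil_at_infinity:
  assumes "coprime a b" "n = max (degree a) (degree b)" "rat_map a b None \<noteq> Some z"
  shows "degree (a - smult z b) = n"
proof -
  have "coeff (a - smult z b) n \<noteq> 0"
    using assms(3) rat_map_coords(2)[OF assms(1,2)]
    by (auto simp: rat_map_None[OF assms(2)] proj_point_def split: if_splits)
  then have "n \<le> degree (a - smult z b)" by (rule le_degree)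
  moreover have "degree (a - smult z b) \<le> n"
    using degree_pencil_le[of a b z 1] assms(2) by (simp add: pencil_def)
  ultimately show ?thesis by (rule order_antisym[rotated])
qed

text \<open>\<open>generic\<close> keeps infinity away from the critical points and values
  concerned, which gives \<open>composition_equation\<close>; \<open>left_factor\<close> lifts this
  restriction by changing coordinates.\<close>

lemma left_factor_normalized:
  assumes F: "simple_rational_function m F" "m \<ge> 4"
    and X: "rational_function_of_degree n X" "n \<ge> 2"
    and Y: "rational_function_of_degree k Y" "k \<ge> 1"
    and G: "rational_function_of_degree l G" "l \<ge> 1"
    and comp: "F \<circ> Y = X \<circ> G"
    and generic: "card (F -` {None}) = m" "card (F -` {F None}) = m"
      "card (F -` {X None}) = m" "card (F -` {F (Y None)}) = m"
  shows "\<exists>n Z. rational_function_of_degree n Z \<and> Y = Z \<circ> G"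
proof -
  have "rational_function_of_degree m F" using F by (simp add: simple_rational_function_def)
  then obtain p q where pq: "coprime p q" "q \<noteq> 0" "m = max (degree p) (degree q)" "F = rat_map p q"
    by (rule rational_function_of_degreeE)
  obtain a' b' where ab': "coprime a' b'" "b' \<noteq> 0" "n = max (degree a') (degree b')" "X = rat_map a' b'"
    by (rule rational_function_of_degreeE[OF X(1)])
  obtain y1 y2 where y: "coprime y1 y2" "y2 \<noteq> 0" "k = max (degree y1) (degree y2)" "Y = rat_map y1 y2"
    by (rule rational_function_of_degreeE[OF Y(1)])
  obtain g1 g2 where g: "coprime g1 g2" "g2 \<noteq> 0" "l = max (degree g1) (degree g2)" "G = rat_map g1 g2"
    by (rule rational_function_of_degreeE[OF G(1)])
  have "rat_map (hom_subst m p y1 y2) (hom_subst m q y1 y2)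
      = rat_map (hom_subst n a' g1 g2) (hom_subst n b' g1 g2)"
    using comp rat_map_comp[OF pq(1) y(1) pq(3)] rat_map_comp[OF ab'(1) g(1) ab'(3)] pq y ab' g
    by simp
  then obtain c where c: "c \<noteq> 0" "hom_subst m p y1 y2 = smult c (hom_subst n a' g1 g2)"
    "hom_subst m q y1 y2 = smult c (hom_subst n b' g1 g2)"
  proof (rule rat_map_eq_proportional[rotated 4])
    show "coprime (hom_subst m p y1 y2) (hom_subst m q y1 y2)"
      using coprime_hom_subst[OF pq(1) y(1) pq(3)] .
    show "coprime (hom_subst n a' g1 g2) (hom_subst n b' g1 g2)"
      using coprime_hom_subst[OF ab'(1) g(1) ab'(3)] .
    show "hom_subst m q y1 y2 \<noteq> 0" using pq y Y by (intro hom_subst_nonzero) auto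
    show "hom_subst n b' g1 g2 \<noteq> 0" using ab' g G by (intro hom_subst_nonzero) auto
  qed
  \<comment> \<open>The two sides agree only up to the scalar \<open>c\<close>, which is absorbed
    into the representation of \<open>X\<close>.\<close>
  define a b where "a = smult c a'" and "b = smult c b'"
  have ab: "coprime a b" "n = max (degree a) (degree b)" "X = rat_map a b"
    using ab' c(1) by (simp_all add: a_def b_def rat_map_smult coprime_complex_poly_iff)
  have eq: "hom_subst m p y1 y2 = hom_subst n a g1 g2" "hom_subst m q y1 y2 = hom_subst n b g1 g2"
    using c by (simp_all add: a_def b_def hom_subst_smult)
  have degrees: "m * k = n * l"
    using max_degree_hom_subst[OF pq(1) y(1) pq(3) y(3)] max_degree_hom_subst[OF ab(1) g(1) ab(2) g(3)] eq
    by simp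
  define C where "C = {x. poly (wronskian p q) x = 0}"
  define v where "v x = poly p x / poly q x" for x
  have m: "m \<ge> 2" "m \<ge> 1" using F by simp_all
  have simple: "card (rat_map p q -` {w}) \<ge> m - 1" for w
    using F pq by (simp add: simple_rational_function_def)
  note inf = generic(1,2)[unfolded pq(4)]
  note crit = simple_critical_points[OF pq(1,3) m(1) simple inf, folded C_def v_def]
  have dpq: "degree p \<le> m" "degree q \<le> m" using pq(3) by simp_all
  have "composition_equation p q a b y1 y2 g1 g2 m n k l C v"
  proof
    show "degree (a - smult (v x) b) = n" if "x \<in> C" for x
      using crit(2)[OF that] generic(3) ab pq by (intro degree_pencil_at_infinity) auto
    show "degree (y1 - smult x y2) = k" if "x \<in> C" for x
      using card_fibre_critical[OF pq(1,3) m(2), of x] that generic(4) y pq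
      by (intro degree_pencil_at_infinity) (auto simp: C_def)
  qed ((fact dpq F(2) crit(1) crit(4) ab(1,2) X(2) y(1,2,3) Y(2) g(1,2,3) G(2) degrees eq
      | erule crit(3))+)
  then interpret E: composition_equation p q a b y1 y2 g1 g2 m n k l C v .
  obtain A0 A1 N where "A0 \<noteq> 0 \<or> A1 \<noteq> 0" "degree A0 \<le> N" "degree A1 \<le> N"
    "y2 * hom_subst N A0 g1 g2 + y1 * hom_subst N A1 g1 g2 = 0"
    by (rule E.linear_relation)
  then show ?thesis
    unfolding y(4) g(4) using y g G by (intro factor_if_linear_relation) auto
qed

section \<open>Changes of coordinate that exchange infinity with a chosen finite point\<close>

definition from_inf :: "complex \<Rightarrow> cp1 \<Rightarrow> cp1" where
  "from_inf c = rat_map [:1, c:] [:0, 1:]"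

definition to_inf :: "complex \<Rightarrow> cp1 \<Rightarrow> cp1" where
  "to_inf c = rat_map [:1:] [:-c, 1:]"

lemma rational_function_of_degree_1_inf:
  "rational_function_of_degree 1 (from_inf c)" "rational_function_of_degree 1 (to_inf c)"
proof -
  have "coprime [:1, c:] [:0, 1:]" "coprime [:1:] [:-c, 1:]"
    by (auto simp: coprime_complex_poly_iff)
  then show "rational_function_of_degree 1 (from_inf c)" "rational_function_of_degree 1 (to_inf c)"
    unfolding rational_function_of_degree_def from_inf_def to_inf_def
    by (intro exI conjI refl; simp)+
qed

lemma from_inf_Some: "from_inf c (Some z) = (if z = 0 then None else Some (c + 1 / z))"
  by (simp add: from_inf_def rat_map_def add_divide_distrib)

lemma from_inf_None [simp]: "from_inf c None = Some c"
  by (simp add: from_inf_def rat_map_def Let_def)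

lemma to_inf_Some: "to_inf c (Some z) = (if z = c then None else Some (1 / (z - c)))"
  by (simp add: to_inf_def rat_map_def)

lemma to_inf_None [simp]: "to_inf c None = Some 0"
  by (simp add: to_inf_def rat_map_def Let_def)

lemma from_inf_to_inf [simp]: "from_inf c (to_inf c w) = w"
  by (cases w) (simp_all add: from_inf_Some to_inf_Some)

lemma to_inf_from_inf [simp]: "to_inf c (from_inf c w) = w"
  by (cases w) (simp_all add: from_inf_Some to_inf_Some)

lemma exists_finite_point_avoiding:
  assumes "rational_function_of_degree n H" "n \<ge> 1" "finite V"
  obtains c where "H (Some c) \<notin> V"
proof -
  have fin: "finite (H -` V)"
  proof -
    have "H -` V = (\<Union>w\<in>V. H -` {w})" by auto
    then show ?thesis using finite_fibre[OF assms(1,2)] assms(3) by simp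
  qed
  then have "finite (Some -` (H -` V))" by (rule finite_vimageI) simp
  then obtain c where "c \<notin> Some -` (H -` V)"
    using ex_new_if_finite infinite_UNIV_char_0 by blast
  then show ?thesis using that by simp
qed

lemma rational_function_of_degree_id: "rational_function_of_degree 1 id"
proof -
  have "to_inf 0 \<circ> from_inf 0 = id" by auto
  then show ?thesis
    using rational_function_of_degree_comp[OF rational_function_of_degree_1_inf(2,1)] by (metis mult_1 order_refl)
qed

lemma rational_function_of_degree_comp_inf:
  assumes "rational_function_of_degree n F" "n \<ge> 1"
  shows "rational_function_of_degree n (to_inf c \<circ> F \<circ> from_inf d)"
    and "rational_function_of_degree n (from_inf c \<circ> F \<circ> to_inf d)"
proof -
  note * = rational_function_of_degree_comp[OF rational_function_of_degree_comp[OF _ assms] _ le_refl]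
  show "rational_function_of_degree n (to_inf c \<circ> F \<circ> from_inf d)"
    using *[OF rational_function_of_degree_1_inf(2,1)] by simp
  show "rational_function_of_degree n (from_inf c \<circ> F \<circ> to_inf d)"
    using *[OF rational_function_of_degree_1_inf(1,2)] by simp
qed

text \<open>Each of the four spheres in the square gets a coordinate in which infinity is generic;
  since there are finitely many critical values, suitable points exist. On the two middle spheres
  the changes of coordinate cancel.\<close>

lemma left_factor:
  assumes F: "simple_rational_function m F" "m \<ge> 4"
    and X: "rational_function_of_degree n X" "n \<ge> 2"
    and Y: "rational_function_of_degree k Y" "k \<ge> 1"
    and G: "rational_function_of_degree l G" "l \<ge> 1"
    and comp: "F \<circ> Y = X \<circ> G"
  obtains n' Z where "n' \<ge> 1" "rational_function_of_degree n' Z" "Y = Z \<circ> G"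
proof -
  have Fm: "rational_function_of_degree m F" and simple: "card (F -` {w}) \<ge> m - 1" for w
    using F by (simp_all add: simple_rational_function_def)
  have m1: "m \<ge> 1" and n1: "n \<ge> 1" using F X by simp_all
  define V where "V = {w. card (F -` {w}) < m}"
  have V: "finite V" unfolding V_def using finite_critical_values[OF Fm m1] .
  have full: "card (F -` {w}) = m" if "w \<notin> V" for w
    using that card_fibre_le[OF Fm m1, of w] by (simp add: V_def)
  obtain cz where cz: "Some cz \<notin> V"
    using exists_finite_point_avoiding[OF rational_function_of_degree_id _ V] by auto
  obtain cx where cx: "F (Some cx) \<notin> V"
    using exists_finite_point_avoiding[OF Fm m1 V] .
  obtain cy where cy: "X (Some cy) \<notin> V"
    using exists_finite_point_avoiding[OF X(1) n1 V] .
  obtain ct where ct: "(F \<circ> Y) (Some ct) \<notin> V"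
    using exists_finite_point_avoiding[OF rational_function_of_degree_comp[OF Fm Y] _ V] m1 Y(2)
    by fastforce
  let ?F = "to_inf cz \<circ> F \<circ> from_inf cx" and ?Y = "to_inf cx \<circ> Y \<circ> from_inf ct"
  let ?X = "to_inf cz \<circ> X \<circ> from_inf cy" and ?G = "to_inf cy \<circ> G \<circ> from_inf ct"
  have card: "card (?F -` {w}) = card (F -` {from_inf cz w})" for w
  proof -
    have "?F -` {w} = from_inf cx -` (F -` {from_inf cz w})"
      by (auto simp: vimage_def)
    moreover have "inj (from_inf cx)" "surj (from_inf cx)"
      by (rule inj_on_inverseI[of _ "to_inf cx"], simp) (rule surjI[of _ "to_inf cx"], simp)
    ultimately show ?thesis by (simp add: card_vimage_inj)
  qed
  have "\<exists>n Z. rational_function_of_degree n Z \<and> ?Y = Z \<circ> ?G"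
  proof (rule left_factor_normalized[where m = m and n = n and k = k and l = l])
    show "simple_rational_function m ?F"
      using F rational_function_of_degree_comp_inf(1)[OF Fm m1] simple
      by (simp add: simple_rational_function_def card del: comp_apply)
    show "?F \<circ> ?Y = ?X \<circ> ?G" using comp by (auto simp: fun_eq_iff)
    show "card (?F -` {None}) = m" "card (?F -` {?F None}) = m"
      "card (?F -` {?X None}) = m" "card (?F -` {?F (?Y None)}) = m"
      unfolding card using full cz cx cy ct by simp_all
  qed (use F X Y G n1 in \<open>simp_all add: rational_function_of_degree_comp_inf\<close>)
  then obtain n' Z where Z: "rational_function_of_degree n' Z" "?Y = Z \<circ> ?G" by blast
  let ?Z = "from_inf cx \<circ> Z \<circ> to_inf cy"
  have "Y w = ?Z (G w)" for w
  proof -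
    have "?Y (to_inf ct w) = (Z \<circ> ?G) (to_inf ct w)" using Z by simp
    then have "to_inf cx (Y w) = Z (to_inf cy (G w))" by simp
    then show ?thesis by (metis comp_apply from_inf_to_inf)
  qed
  then have YZ: "Y = ?Z \<circ> G" by auto
  have "n' \<noteq> 0"
  proof
    assume "n' = 0"
    then obtain d where "\<And>w. Z w = d" using Z rational_function_of_degree_0 by blast
    then have "Y w = Y None" for w by (simp add: YZ)
    moreover have "surj Y" using surj_rational_function[OF Y] .
    then obtain w1 w2 where "Y w1 = None" "Y w2 = Some 0" by (metis surjD)
    ultimately show False by (metis option.distinct(1))
  qed
  then have n': "n' \<ge> 1" by simp
  show ?thesis by (rule that[OF n' rational_function_of_degree_comp_inf(2)[OF Z(1) n'] YZ])
qed

section \<open>Iterates and descent on the degree of \<open>X\<close>\<close>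

lemma rational_function_of_degree_funpow:
  assumes "rational_function_of_degree m F" "m \<ge> 1"
  shows "rational_function_of_degree (m ^ r) (F ^^ r)"
proof (induction r)
  case 0
  then show ?case using rational_function_of_degree_id by (simp add: id_def)
next
  case (Suc r)
  then show ?case
    using rational_function_of_degree_comp[OF assms(1) Suc] assms(2)
    by (simp only: power_Suc funpow.simps one_le_power)
qed

text \<open>For \<open>n = 1\<close> the map \<open>X\<close> itself is \<open>\<mu>\<close>.
  Otherwise \<open>left_factor\<close> yields a map \<open>Z\<close> of degree \<open>n / m\<close>
  that solves the same equation.\<close>

lemma semiconjugacy_descent:
  assumes F: "simple_rational_function m F" "m \<ge> 4" and r: "r \<ge> 1"
    and X: "rational_function_of_degree n X" "n \<ge> 1"
    and G: "rational_function_of_degree l G" "l \<ge> 1"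
    and eq: "(F ^^ r) \<circ> X = X \<circ> G"
  shows "\<exists>\<mu> j. rational_function_of_degree 1 \<mu> \<and> X = (F ^^ j) \<circ> \<mu> \<and> (F ^^ r) \<circ> \<mu> = \<mu> \<circ> G"
  using X eq
proof (induction n arbitrary: X rule: less_induct)
  case (less n)
  show ?case
  proof (cases "n = 1")
    case True
    then show ?thesis using less.prems by (intro exI[of _ X] exI[of _ 0]) simp
  next
    case False
    then have n2: "n \<ge> 2" using less.prems by simp
    have Fm: "rational_function_of_degree m F" using F by (simp add: simple_rational_function_def)
    have m1: "m \<ge> 1" using F by simp
    obtain s where s: "r = Suc s" using r not0_implies_Suc by force
    let ?Y = "(F ^^ s) \<circ> X"
    have FY: "F \<circ> ?Y = X \<circ> G" using less.prems(3) by (simp add: s fun_eq_iff)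
    have Y: "rational_function_of_degree (m ^ s * n) ?Y" "m ^ s * n \<ge> 1"
      using rational_function_of_degree_comp[OF rational_function_of_degree_funpow[OF Fm m1] less.prems(1,2)]
        m1 less.prems(2) by simp_all
    obtain n' Z where Z: "n' \<ge> 1" "rational_function_of_degree n' Z" "?Y = Z \<circ> G"
      by (rule left_factor[OF F less.prems(1) n2 Y G FY])
    \<comment> \<open>\<open>G\<close> is surjective, so it can be cancelled on the right of
      \<open>F \<circ> Z \<circ> G = X \<circ> G\<close>.\<close>
    have XZ: "X = F \<circ> Z"
    proof
      fix w
      obtain t where t: "w = G t" using surj_rational_function[OF G] by (rule surjE)
      have "X (G t) = F (?Y t)" using fun_cong[OF FY, of t] by simp
      also have "?Y t = Z (G t)" using fun_cong[OF Z(3), of t] by simp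
      finally show "X w = (F \<circ> Z) w" by (simp add: t)
    qed
    have "n = m * n'"
      by (rule rational_function_degree_unique[OF less.prems(1)[unfolded XZ]
            rational_function_of_degree_comp[OF Fm Z(2,1)]])
    then have "n' < n" using F(2) Z(1) by simp
    moreover have "(F ^^ r) \<circ> Z = Z \<circ> G"
    proof -
      have "(F ^^ r) \<circ> Z = (F ^^ s) \<circ> (F \<circ> Z)" by (simp only: s funpow_Suc_right comp_assoc)
      then show ?thesis using XZ Z(3) by simp
    qed
    ultimately obtain \<mu> j where \<mu>: "rational_function_of_degree 1 \<mu>" "Z = (F ^^ j) \<circ> \<mu>"
      "(F ^^ r) \<circ> \<mu> = \<mu> \<circ> G"
      using less.IH[OF _ Z(2,1)] by blast
    moreover have "X = (F ^^ Suc j) \<circ> \<mu>" using XZ \<mu>(2) by (simp add: comp_assoc)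
    ultimately show ?thesis by blast
  qed
qed

theorem theorem1p4:
  fixes F G X :: "cp1 \<Rightarrow> cp1" and m r :: nat
  assumes "simple_rational_function m F" and "m \<ge> 4" and "r \<ge> 1"
    and "rational_function G" and "\<nexists>c. \<forall>z. G z = c"
    and "rational_function X" and "\<nexists>c. \<forall>z. X z = c"
    and "(F ^^ r) \<circ> X = X \<circ> G"
  shows "\<exists>\<mu> (l::nat). moebius \<mu> \<and> X = (F ^^ l) \<circ> \<mu> \<and> G = inv \<mu> \<circ> (F ^^ r) \<circ> \<mu>"
proof -
  obtain k where "k \<ge> 1" "rational_function_of_degree k G"
    using rational_function_nonconstantE assms(4,5) by blast
  moreover obtain n where "n \<ge> 1" "rational_function_of_degree n X"
    using rational_function_nonconstantE assms(6,7) by blast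
  ultimately obtain \<mu> l where \<mu>: "rational_function_of_degree 1 \<mu>" "X = (F ^^ l) \<circ> \<mu>"
    "(F ^^ r) \<circ> \<mu> = \<mu> \<circ> G"
    using semiconjugacy_descent assms by blast
  have "inv \<mu> \<circ> (F ^^ r) \<circ> \<mu> = (inv \<mu> \<circ> \<mu>) \<circ> G" by (simp only: \<mu>(3) comp_assoc)
  also have "\<dots> = G" using inj_rational_function_of_degree_1[OF \<mu>(1)] by simp
  finally show ?thesis using \<mu> moebius_if_degree_1 by metis
qed

end
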